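(* For every $n\ge 2$, the gap process $\mathbf{Y}=(Y_1,\dots,Y_{n-1})$ (the Markov process on $\mathbb{R}_+^{n-1}$ with generator $\mathcal{L}_n$ described in the context) has a unique stationary distribution $\pi_n$.
   Context: Fix $n\ge 2$ and a probability law $\theta$ on $(0,\infty)$ with $\int z\,\theta(dz)=1$. The $n$-particle Stochastic Follow-the-Leader system $\mathbf{X}=(X_1,\dots,X_n)$ on $\mathbb{R}$, with $X_n(t)<\dots<X_1(t)$, evolves as a pure jump Markov process: the leader $X_1$ jumps forward at rate $1$ with i.i.d. jump sizes of law $\theta$; for $i\ge 2$, particle $X_i$ jumps at rate $X_{i-1}-X_i$ to a location chosen uniformly in $(X_i,X_{i-1})$. The gap process is $Y_i(t)=X_i(t)-X_{i+1}(t)$, $i=1,\dots,n-1$; it is a Markov process on $\mathbb{R}_+^{n-1}$ whose generator acts on bounded measurable $f$ by $$\mathcal{L}_nf(\mathbf{y})=y_{n-1}\mathbb{E}_U[f(\mathbf{y}-y_{n-1}Ue_{n-1})-f(\mathbf{y})]+\sum_{i=1}^{n-2}y_i\mathbb{E}_U[f(\mathbf{y}+y_iU(e_{i+1}-e_i))-f(\mathbf{y})]+\mathbb{E}_\theta[f(\mathbf{y}+Ze_1)-f(\mathbf{y})],$$ where $U\sim\mathrm{U}(0,1)$, $Z\sim\theta$, and $e_i$ are the standard basis vectors. $\mathbb{P}_{\mathbf{y}}$ denotes the law of $\mathbf{Y}$ started at $\mathbf{y}$. *)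

theory Defs
  imports "HOL-Probability.Probability"
begin

text \<open>Gap configurations with m = n - 1 gaps are encoded as functions y :: nat \<Rightarrow> real,
  where y i (i < m) is the paper's Y_{i+1}, and y i = 0 for i \<ge> m.
  The measurable space is the Borel space of the product topology on nat \<Rightarrow> real.\<close>

definition gap_space :: "nat \<Rightarrow> (nat \<Rightarrow> real) set" where
  "gap_space m = {y. (\<forall>i<m. 0 \<le> y i) \<and> (\<forall>i\<ge>m. y i = 0)}"

definition unit_vec :: "nat \<Rightarrow> nat \<Rightarrow> real" where
  "unit_vec i = (\<lambda>j. if j = i then 1 else 0)"

text \<open>Total jump rate in state y: y_1 + ... + y_{n-1} (particles 2..n) plus 1 (leader).\<close>
definition total_rate :: "nat \<Rightarrow> (nat \<Rightarrow> real) \<Rightarrow> real" where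
  "total_rate m y = (\<Sum>i<m. y i) + 1"

text \<open>Jump-rate kernel (unnormalised), applied to a nonnegative function g:
  the jump part of the generator L_n, i.e. L_n g y = jump_op g y - total_rate y * g y.\<close>
definition jump_op :: "nat \<Rightarrow> real measure \<Rightarrow> ((nat \<Rightarrow> real) \<Rightarrow> ennreal) \<Rightarrow> (nat \<Rightarrow> real) \<Rightarrow> ennreal" where
  "jump_op m \<theta> g y =
     ennreal (y (m - 1)) *
       (\<integral>\<^sup>+ u. indicator {0..1} u * g (\<lambda>j. y j - y (m - 1) * u * unit_vec (m - 1) j) \<partial>lborel)
   + (\<Sum>i<m - 1. ennreal (y i) *
       (\<integral>\<^sup>+ u. indicator {0..1} u * g (\<lambda>j. y j + y i * u * (unit_vec (Suc i) j - unit_vec i j)) \<partial>lborel))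
   + (\<integral>\<^sup>+ z. g (\<lambda>j. y j + z * unit_vec 0 j) \<partial>\<theta>)"

text \<open>Minimal (Feller) construction of the transition function of the pure jump process:
  trans_k k t f y = E_y[f(Y_t); exactly k jumps up to time t].\<close>
fun trans_k :: "nat \<Rightarrow> nat \<Rightarrow> real measure \<Rightarrow> real \<Rightarrow> ((nat \<Rightarrow> real) \<Rightarrow> ennreal) \<Rightarrow> (nat \<Rightarrow> real) \<Rightarrow> ennreal" where
  "trans_k 0 m \<theta> t f y = ennreal (exp (- total_rate m y * t)) * f y"
| "trans_k (Suc k) m \<theta> t f y =
     (\<integral>\<^sup>+ s. indicator {0..t} s * ennreal (exp (- total_rate m y * s)) *
             jump_op m \<theta> (\<lambda>z. trans_k k m \<theta> (t - s) f z) y \<partial>lborel)"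

definition trans :: "nat \<Rightarrow> real measure \<Rightarrow> real \<Rightarrow> ((nat \<Rightarrow> real) \<Rightarrow> ennreal) \<Rightarrow> (nat \<Rightarrow> real) \<Rightarrow> ennreal" where
  "trans m \<theta> t f y = (\<Sum>k. trans_k k m \<theta> t f y)"

definition stationary_gap :: "nat \<Rightarrow> real measure \<Rightarrow> (nat \<Rightarrow> real) measure \<Rightarrow> bool" where
  "stationary_gap m \<theta> \<pi> \<longleftrightarrow>
     prob_space \<pi> \<and> sets \<pi> = sets borel \<and> emeasure \<pi> (gap_space m) = 1 \<and>
     (\<forall>t\<ge>0. \<forall>A\<in>sets borel.
        (\<integral>\<^sup>+ y. trans m \<theta> t (indicator A) y \<partial>\<pi>) = emeasure \<pi> A)"

end

theory Submission
  imports Defs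
begin

text \<open>
  Let \<open>P\<^sub>t\<close> be the minimal semigroup and \<open>R = \<integral>\<^sub>0\<^sup>\<infinity> e\<^sup>-\<^sup>t P\<^sub>t dt\<close> its resolvent. Conditioning on the first
  jump gives \<open>R f = \<Sum>\<^sub>k A\<^sup>k (r f)\<close>, where \<open>r = 1 / (q + 1)\<close>, \<open>q\<close> is the total jump rate and \<open>A = r J\<close>
  with \<open>J\<close> the jump operator.

  With \<open>V y = \<Sum>\<^sub>i (m - i) y\<^sub>i\<close>, every jump of a follower out of gap \<open>i\<close> lowers \<open>V\<close> by the uniform
  fraction of \<open>y\<^sub>i\<close> that is moved, so the drift of \<open>V\<close> is \<open>m - (\<Sum>\<^sub>i y\<^sub>i\<^sup>2) / 2\<close>. Boundedness of
  this drift from above excludes explosion. As the negative part is quadratic, the process comes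
  down from infinity: the bounded function \<open>w = 1 / (1 + V)\<close> satisfies \<open>R w \<ge> c > 0\<close> everywhere.

  From a level set of \<open>V\<close>, one jump of the leader followed by one jump of each follower in turn
  resamples all gaps and dominates a multiple of the uniform law on a small cube, because rate times
  jump density of a follower is 1. Hence \<open>R \<circ> R\<close> has a uniform Doeblin minorization and
  exactly one invariant law. As \<open>P\<^sub>t\<close> commutes with \<open>R\<close>, this law is invariant for every \<open>P\<^sub>t\<close>.
\<close>

section \<open>Positive kernels as operators\<close>

text \<open>On Borel functions such an operator is integration against a measurable family of
  measures. The operator form is used because \<open>jump_op\<close> and \<open>trans_k\<close> are
  themselves given by their action on functions.\<close>

locale kernel_op =
  fixes T :: "('a::topological_space \<Rightarrow> ennreal) \<Rightarrow> 'a \<Rightarrow> ennreal"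
  assumes meas: "f \<in> borel_measurable borel \<Longrightarrow> T f \<in> borel_measurable borel"
    and add: "f \<in> borel_measurable borel \<Longrightarrow> g \<in> borel_measurable borel \<Longrightarrow>
      T (\<lambda>x. f x + g x) y = T f y + T g y"
    and cmult: "f \<in> borel_measurable borel \<Longrightarrow> T (\<lambda>x. c * f x) y = c * T f y"
    and SUP: "(\<And>i::nat. F i \<in> borel_measurable borel) \<Longrightarrow> incseq F \<Longrightarrow>
      T (\<lambda>x. SUP i. F i x) y = (SUP i. T (F i) y)"
begin

lemma zero: "T (\<lambda>x. 0) y = 0"
  using cmult[of "\<lambda>x. 0" 0 y] by simp

lemma mono:
  assumes [measurable]: "f \<in> borel_measurable borel" "g \<in> borel_measurable borel"
    and le: "\<And>x. f x \<le> g x"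
  shows "T f y \<le> T g y"
proof -
  define F where "F = (\<lambda>i::nat. if i = 0 then f else g)"
  have "T (\<lambda>x. SUP i. F i x) y = (SUP i. T (F i) y)"
    by (rule SUP) (auto simp: F_def incseq_def le_fun_def le)
  moreover have "(SUP i. F i x) = g x" for x
    by (rule antisym) (auto simp: F_def le intro!: SUP_least SUP_upper2[of 1])
  moreover have "T (F 0) y \<le> (SUP i. T (F i) y)"
    by (rule SUP_upper) simp
  ultimately show ?thesis by (simp add: F_def)
qed

lemma sum:
  assumes "\<And>i. i \<in> I \<Longrightarrow> F i \<in> borel_measurable borel"
  shows "T (\<lambda>x. \<Sum>i\<in>I. F i x) y = (\<Sum>i\<in>I. T (F i) y)"
  using assms
  by (induction I rule: infinite_finite_induct) (auto simp: zero add)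

lemma suminf:
  assumes [measurable]: "\<And>i. F i \<in> borel_measurable borel"
  shows "T (\<lambda>x. \<Sum>i. F i x) y = (\<Sum>i. T (F i) y)"
proof -
  have "T (\<lambda>x. \<Sum>i. F i x) y = T (\<lambda>x. SUP n. \<Sum>i<n. F i x) y"
    by (simp add: suminf_eq_SUP)
  also have "\<dots> = (SUP n. T (\<lambda>x. \<Sum>i<n. F i x) y)"
    by (rule SUP) (auto simp: incseq_def le_fun_def intro!: sum_mono2)
  also have "\<dots> = (\<Sum>i. T (F i) y)"
    by (simp add: suminf_eq_SUP sum)
  finally show ?thesis .
qed

end

section \<open>Action of kernels on measures\<close>

definition push :: "'a measure \<Rightarrow> (('a \<Rightarrow> ennreal) \<Rightarrow> 'a \<Rightarrow> ennreal) \<Rightarrow> 'a::topological_space measure" where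
  "push \<mu> T = measure_of UNIV (sets borel) (\<lambda>A. \<integral>\<^sup>+ y. T (indicator A) y \<partial>\<mu>)"

lemma sets_push [simp, measurable_cong]: "sets (push \<mu> T) = sets borel"
  using sets.sigma_sets_eq[of borel] by (simp add: push_def)

lemma space_push [simp]: "space (push \<mu> T) = UNIV"
  using sets_eq_imp_space_eq[OF sets_push] by simp

lemma emeasure_measure_of_borel:
  assumes "\<mu> {} = 0" "\<And>F. range F \<subseteq> sets borel \<Longrightarrow> disjoint_family F \<Longrightarrow> (\<Sum>i. \<mu> (F i)) = \<mu> (\<Union>i. F i)"
    and "A \<in> sets (borel :: 'a::topological_space measure)"
  shows "emeasure (measure_of UNIV (sets borel) \<mu>) A = (\<mu> A :: ennreal)"
  using assms sets.sigma_algebra_axioms[of borel]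
  by (intro emeasure_measure_of_sigma) (auto simp: positive_def countably_additive_def)

lemma emeasure_push:
  assumes "kernel_op T" and [measurable_cong]: "sets \<mu> = sets borel" and A: "A \<in> sets borel"
  shows "emeasure (push \<mu> T) A = (\<integral>\<^sup>+ y. T (indicator A) y \<partial>\<mu>)"
  unfolding push_def
proof (rule emeasure_measure_of_borel[OF _ _ A])
  interpret kernel_op T by fact
  note meas[measurable]
  show "(\<integral>\<^sup>+ y. T (indicator {}) y \<partial>\<mu>) = 0"
    using zero by (simp add: indicator_def[abs_def])
  fix F :: "nat \<Rightarrow> 'a set" assume F: "range F \<subseteq> sets borel" "disjoint_family F"
  then have [measurable]: "F i \<in> sets borel" for i by auto
  have "(\<Sum>i. \<integral>\<^sup>+ y. T (indicator (F i)) y \<partial>\<mu>) = (\<integral>\<^sup>+ y. (\<Sum>i. T (indicator (F i)) y) \<partial>\<mu>)"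
    by (rule nn_integral_suminf[symmetric]) simp
  also have "\<dots> = (\<integral>\<^sup>+ y. T (\<lambda>x. \<Sum>i. indicator (F i) x) y \<partial>\<mu>)"
    by (subst suminf) auto
  also have "(\<lambda>x. \<Sum>i. indicator (F i) x :: ennreal) = indicator (\<Union>i. F i)"
    by (rule ext) (rule suminf_indicator[OF F(2)])
  finally show "(\<Sum>i. \<integral>\<^sup>+ y. T (indicator (F i)) y \<partial>\<mu>) = (\<integral>\<^sup>+ y. T (indicator (\<Union>i. F i)) y \<partial>\<mu>)" .
qed

lemma nn_integral_push:
  assumes "kernel_op T" and [measurable_cong]: "sets \<mu> = sets borel" and "f \<in> borel_measurable borel"
  shows "(\<integral>\<^sup>+ y. f y \<partial>push \<mu> T) = (\<integral>\<^sup>+ y. T f y \<partial>\<mu>)"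
  using assms(3)
proof (induction rule: borel_measurable_induct)
  case (cong f g)
  then have "f = g" by auto
  then show ?case using cong by simp
next
  case (set A)
  then show ?case using emeasure_push[OF assms(1,2)] by simp
next
  case (mult u c)
  interpret kernel_op T by fact
  note meas[measurable] mult(2)[measurable]
  show ?case using mult by (simp add: nn_integral_cmult cmult)
next
  case (add u v)
  note IH = add
  interpret kernel_op T by fact
  note meas[measurable] IH(1,4)[measurable]
  show ?case using IH by (simp add: nn_integral_add add)
next
  case (seq U)
  interpret kernel_op T by fact
  note meas[measurable] seq(1)[measurable]
  have inc: "incseq (\<lambda>i. T (U i))"
    using seq by (auto simp: incseq_def le_fun_def intro!: mono)
  have "(\<integral>\<^sup>+ y. (SUP i. U i) y \<partial>push \<mu> T) = (SUP i. \<integral>\<^sup>+ y. U i y \<partial>push \<mu> T)"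
    using seq by (simp add: nn_integral_monotone_convergence_SUP image_comp)
  also have "\<dots> = (SUP i. \<integral>\<^sup>+ y. T (U i) y \<partial>\<mu>)"
    using seq by simp
  also have "\<dots> = (\<integral>\<^sup>+ y. (SUP i. T (U i) y) \<partial>\<mu>)"
    using inc by (simp add: nn_integral_monotone_convergence_SUP)
  also have "\<dots> = (\<integral>\<^sup>+ y. T (SUP i. U i) y \<partial>\<mu>)"
    using seq SUP[of U] by (simp add: image_comp SUP_apply[abs_def])
  finally show ?case .
qed

lemma kernel_op_comp:
  assumes "kernel_op S" "kernel_op T"
  shows "kernel_op (\<lambda>f. S (T f))"
proof -
  interpret S: kernel_op S by fact
  interpret T: kernel_op T by fact
  have a: "T (\<lambda>x. f x + g x) = (\<lambda>y. T f y + T g y)"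
    if "f \<in> borel_measurable borel" "g \<in> borel_measurable borel" for f g
    using that by (auto simp: T.add)
  have b: "T (\<lambda>x. c * f x) = (\<lambda>y. c * T f y)"
    if "f \<in> borel_measurable borel" for c f
    using that by (auto simp: T.cmult)
  have c: "T (\<lambda>x. SUP i. F i x) = (\<lambda>y. SUP i. T (F i) y)"
    if "\<And>i::nat. F i \<in> borel_measurable borel" "incseq F" for F
    using that by (auto simp: T.SUP)
  show ?thesis
  proof
    fix F :: "nat \<Rightarrow> 'a \<Rightarrow> ennreal" and y 
    assume F: "\<And>i. F i \<in> borel_measurable borel" "incseq F"
    have "incseq (\<lambda>i. T (F i))"
      using F by (auto simp: incseq_def le_fun_def intro!: T.mono)
    with F show "S (T (\<lambda>x. SUP i. F i x)) y = (SUP i. S (T (F i)) y)"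
      by (simp add: c S.SUP T.meas)
  qed (simp_all add: a b S.meas T.meas S.add S.cmult)
qed

lemma kernel_op_suminf:
  assumes "\<And>k::nat. kernel_op (T k)"
  shows "kernel_op (\<lambda>f y. \<Sum>k. T k f y)"
proof -
  have [measurable]: "T k f \<in> borel_measurable borel" if "f \<in> borel_measurable borel" for k f
    using that by (rule kernel_op.meas[OF assms])
  show ?thesis
  proof
    fix F :: "nat \<Rightarrow> 'a \<Rightarrow> ennreal" and y 
    assume F: "\<And>i. F i \<in> borel_measurable borel" "incseq F"
    then have "incseq (\<lambda>i. T k (F i) y)" for k
      by (auto simp: incseq_def le_fun_def intro!: kernel_op.mono[OF assms])
    then show "(\<Sum>k. T k (\<lambda>x. SUP i. F i x) y) = (SUP i. \<Sum>k. T k (F i) y)"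
      using F by (simp add: kernel_op.SUP[OF assms] ennreal_suminf_SUP_eq)
  qed (simp_all add: kernel_op.add[OF assms] kernel_op.cmult[OF assms] suminf_add)
qed

text \<open>Pushing the Dirac mass at \<open>y\<close> produces the kernel measure at
  \<open>y\<close>; with \<open>T f y\<close> written as an integral, Fubini becomes
  available.\<close>

lemma kernel_op_at:
  assumes "kernel_op T" "f \<in> borel_measurable borel"
  shows "T f y = (\<integral>\<^sup>+ x. f x \<partial>push (return borel y) T)"
  using assms by (simp add: nn_integral_push nn_integral_return kernel_op.meas)

text \<open>Fubini for \<open>N\<close> and the kernel measure at \<open>y\<close>, which is finite
  because \<open>T 1\<close> is finite there.\<close>

lemma kernel_op_nn_integral:
  assumes T: "kernel_op T" and fin: "T (\<lambda>_. 1) y < \<top>" and "sigma_finite_measure N"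
    and [measurable]: "(\<lambda>(s, z). g s z) \<in> borel_measurable (N \<Otimes>\<^sub>M borel)"
  shows "T (\<lambda>z. \<integral>\<^sup>+ s. g s z \<partial>N) y = (\<integral>\<^sup>+ s. T (g s) y \<partial>N)"
proof -
  let ?K = "push (return borel y) T"
  have "emeasure ?K (space ?K) = T (\<lambda>_. 1) y"
    using kernel_op_at[OF T, of "\<lambda>_. 1" y] by simp
  then interpret K: finite_measure ?K
    using fin by (intro finite_measureI) auto
  interpret N: sigma_finite_measure N by fact
  interpret P: pair_sigma_finite N ?K ..
  have g: "g s \<in> borel_measurable borel" if "s \<in> space N" for s
    using that by measurable
  have "T (\<lambda>z. \<integral>\<^sup>+ s. g s z \<partial>N) y = (\<integral>\<^sup>+ z. (\<integral>\<^sup>+ s. g s z \<partial>N) \<partial>?K)"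
    by (rule kernel_op_at[OF T]) measurable
  also have "\<dots> = (\<integral>\<^sup>+ s. (\<integral>\<^sup>+ z. g s z \<partial>?K) \<partial>N)"
    by (rule P.Fubini') measurable
  also have "\<dots> = (\<integral>\<^sup>+ s. T (g s) y \<partial>N)"
    by (rule nn_integral_cong) (simp add: kernel_op_at[OF T g, symmetric])
  finally show ?thesis .
qed

section \<open>Invariant law under a Doeblin condition\<close>

lemma nn_integral_setwise_mono:
  assumes "sets \<sigma> = sets (borel :: 'a::topological_space measure)" "sets p = sets borel"
    and "\<And>A. A \<in> sets borel \<Longrightarrow> emeasure \<sigma> A \<le> emeasure p A"
    and "f \<in> borel_measurable borel"
  shows "(\<integral>\<^sup>+ x. f x \<partial>\<sigma>) \<le> (\<integral>\<^sup>+ x. f x \<partial>p)"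
proof -
  have "\<sigma> \<le> p"
    using assms(1-3) by (simp add: le_measure)
  then show ?thesis
    using assms by (intro nn_integral_mono_measure) auto
qed

text \<open>For equal total masses, the inequality on the complement is the reverse inequality on
  the set.\<close>

lemma setwise_le_imp_eq:
  assumes "sets \<sigma> = sets (borel :: 'a::topological_space measure)" "sets p = sets borel"
    and le: "\<And>A. A \<in> sets borel \<Longrightarrow> emeasure \<sigma> A \<le> emeasure p A"
    and "emeasure \<sigma> UNIV = 1" "emeasure p UNIV = 1"
  shows "\<sigma> = p"
proof (rule measure_eqI)
  fix A assume A: "A \<in> sets \<sigma>"
  have sp: "space \<sigma> = UNIV" "space p = UNIV"
    using assms(1,2) sets_eq_imp_space_eq[of _ borel] by auto
  have cA: "A \<in> sets borel" "- A \<in> sets borel" using A assms(1) by auto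
  interpret \<sigma>: prob_space \<sigma> using assms sp by (intro prob_spaceI) simp
  interpret p: prob_space p using assms sp by (intro prob_spaceI) simp
  have "measure \<sigma> B \<le> measure p B" if "B \<in> sets borel" for B
    using le[OF that] by (simp add: \<sigma>.emeasure_eq_measure p.emeasure_eq_measure)
  from this[OF cA(1)] this[OF cA(2)] have "\<sigma>.prob A = p.prob A"
    using \<sigma>.prob_compl[of A] p.prob_compl[of A] cA assms(1,2) sp by (auto simp: Compl_eq_Diff_UNIV)
  then show "emeasure \<sigma> A = emeasure p A"
    by (simp add: \<sigma>.emeasure_eq_measure p.emeasure_eq_measure)
qed (use assms in auto)

text \<open>
  If \<open>T f \<ge> \<epsilon> \<nu>(f)\<close>, then \<open>\<sigma> \<mapsto> \<sigma>T + \<epsilon> (1 - \<sigma>(1)) \<nu>\<close> is monotone on subprobability measures: it equals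
  \<open>\<sigma>(T - \<epsilon>\<nu>) + \<epsilon>\<nu>\<close>. On probability measures its fixed points are the invariant laws of \<open>T\<close>.
  Its Kleene iterates from the zero measure have mass \<open>1 - (1 - \<epsilon>)\<^sup>k\<close>, so their limit is a
  probability measure below every invariant law, and therefore the only one.
\<close>

definition doeblin_map ::
  "(('a \<Rightarrow> ennreal) \<Rightarrow> 'a \<Rightarrow> ennreal) \<Rightarrow> ennreal \<Rightarrow> 'a measure \<Rightarrow> 'a measure \<Rightarrow> 'a::topological_space measure" where
  "doeblin_map T \<epsilon> \<nu> \<sigma> = measure_of UNIV (sets borel)
     (\<lambda>A. emeasure (push \<sigma> T) A + \<epsilon> * (1 - emeasure \<sigma> UNIV) * emeasure \<nu> A)"

lemma sets_doeblin_map [simp, measurable_cong]: "sets (doeblin_map T \<epsilon> \<nu> \<sigma>) = sets borel"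
  using sets.sigma_sets_eq[of borel] by (simp add: doeblin_map_def)

lemma emeasure_doeblin_map:
  assumes "sets \<nu> = sets borel" "A \<in> sets borel"
  shows "emeasure (doeblin_map T \<epsilon> \<nu> \<sigma>) A =
    emeasure (push \<sigma> T) A + \<epsilon> * (1 - emeasure \<sigma> UNIV) * emeasure \<nu> A"
  unfolding doeblin_map_def using assms
  by (intro emeasure_measure_of_borel)
     (auto simp: suminf_add[symmetric] suminf_emeasure)

text \<open>The conditions on mass and minorization are imposed on \<open>G\<close> only: off the
  gap space the operators to which this is applied need not be Markov.\<close>

locale doeblin = kernel_op T for T :: "('a::topological_space \<Rightarrow> ennreal) \<Rightarrow> 'a \<Rightarrow> ennreal" +
  fixes G :: "'a set" and \<nu> :: "'a measure" and \<epsilon> :: real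
  assumes G [measurable]: "G \<in> sets borel" and G_ne: "G \<noteq> {}"
    and T1: "y \<in> G \<Longrightarrow> T (\<lambda>_. 1) y = 1"
    and TG: "y \<in> G \<Longrightarrow> T (indicator (- G)) y = 0"
    and nu_prob: "prob_space \<nu>" and nu_sets [measurable_cong]: "sets \<nu> = sets borel"
    and eps: "0 < \<epsilon>"
    and minor: "y \<in> G \<Longrightarrow> f \<in> borel_measurable borel \<Longrightarrow> ennreal \<epsilon> * (\<integral>\<^sup>+ x. f x \<partial>\<nu>) \<le> T f y"
begin

definition carried :: "'a measure \<Rightarrow> bool" where
  "carried \<sigma> \<longleftrightarrow> sets \<sigma> = sets borel \<and> emeasure \<sigma> UNIV \<le> 1 \<and> emeasure \<sigma> (- G) = 0"

lemma carriedD: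
  assumes "carried \<sigma>"
  shows "sets \<sigma> = sets borel" "space \<sigma> = UNIV" "emeasure \<sigma> UNIV \<le> 1" "AE x in \<sigma>. x \<in> G"
proof -
  from assms have [measurable_cong]: "sets \<sigma> = sets borel" and "emeasure \<sigma> (- G) = 0"
    by (auto simp: carried_def)
  moreover from this(1) show sp: "space \<sigma> = UNIV" using sets_eq_imp_space_eq[of \<sigma> borel] by simp
  ultimately have "- G \<in> null_sets \<sigma>" by (auto intro!: null_setsI)
  from AE_not_in[OF this] show "AE x in \<sigma>. x \<in> G" by simp
qed (use assms in \<open>auto simp: carried_def\<close>)

lemma doeblin_map_mono:
  assumes \<sigma>: "carried \<sigma>" and p: "carried p"
    and le: "\<And>A. A \<in> sets borel \<Longrightarrow> emeasure \<sigma> A \<le> emeasure p A"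
    and A: "A \<in> sets borel"
  shows "emeasure (doeblin_map T \<epsilon> \<nu> \<sigma>) A \<le> emeasure (doeblin_map T \<epsilon> \<nu> p) A"
proof -
  note [measurable] = A meas and [measurable_cong] = carriedD(1)[OF \<sigma>] carriedD(1)[OF p]
  note nA = nu_sets A
  define c where "c = ennreal \<epsilon> * emeasure \<nu> A"
  \<comment> \<open>The remainder after removing \<open>\<epsilon> \<nu>\<close>. It is set to 0 off
    \<open>G\<close>, where no minorization is assumed and truncated subtraction need not be undone
    by adding \<open>c\<close>.\<close>
  define g where "g y = (if y \<in> G then T (indicator A) y - c else 0)" for y
  have [measurable]: "g \<in> borel_measurable borel" unfolding g_def by measurable
  have Tg: "T (indicator A) y = g y + c" if "y \<in> G" for y
    using minor[OF that, of "indicator A"] that nA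
    by (simp add: g_def c_def diff_add_cancel_ennreal)
  \<comment> \<open>The two terms containing the mass of \<open>\<mu>\<close> combine to the
    constant \<open>c\<close>, so \<open>\<mu>\<close> enters only through the integral of a
    nonnegative function.\<close>
  have *: "emeasure (push \<mu> T) A + ennreal \<epsilon> * (1 - emeasure \<mu> UNIV) * emeasure \<nu> A = (\<integral>\<^sup>+ y. g y \<partial>\<mu>) + c"
    if \<mu>: "carried \<mu>" for \<mu>
  proof -
    note [measurable_cong] = carriedD(1)[OF \<mu>]
    have "emeasure (push \<mu> T) A = (\<integral>\<^sup>+ y. T (indicator A) y \<partial>\<mu>)"
      by (rule emeasure_push[OF kernel_op_axioms carriedD(1)[OF \<mu>] A])
    also have "\<dots> = (\<integral>\<^sup>+ y. g y + c \<partial>\<mu>)"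
      using carriedD(4)[OF \<mu>] by (intro nn_integral_cong_AE) (auto simp: Tg)
    also have "\<dots> = (\<integral>\<^sup>+ y. g y \<partial>\<mu>) + c * emeasure \<mu> UNIV"
      by (simp add: nn_integral_add carriedD(2)[OF \<mu>])
    also have "\<dots> + ennreal \<epsilon> * (1 - emeasure \<mu> UNIV) * emeasure \<nu> A
       = (\<integral>\<^sup>+ y. g y \<partial>\<mu>) + c * (emeasure \<mu> UNIV + (1 - emeasure \<mu> UNIV))"
      by (simp add: c_def algebra_simps)
    also have "emeasure \<mu> UNIV + (1 - emeasure \<mu> UNIV) = 1"
      using carriedD(3)[OF \<mu>] by (simp add: add_diff_inverse_ennreal)
    finally show ?thesis by simp
  qed
  have "(\<integral>\<^sup>+ y. g y \<partial>\<sigma>) \<le> (\<integral>\<^sup>+ y. g y \<partial>p)"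
    by (rule nn_integral_setwise_mono) (use \<sigma> p le in \<open>auto simp: carried_def\<close>)
  then show ?thesis
    using nA by (simp add: emeasure_doeblin_map * \<sigma> p add_right_mono)
qed

lemma eps_le: "\<epsilon> \<le> 1"
proof -
  obtain y where "y \<in> G" using G_ne by auto
  then have "ennreal \<epsilon> * emeasure \<nu> (space \<nu>) \<le> 1"
    using minor[of y "\<lambda>_. 1"] T1[of y] by simp
  then show ?thesis using prob_space.emeasure_space_1[OF nu_prob] by simp
qed

lemma nu_UNIV: "emeasure \<nu> UNIV = 1"
  using prob_space.emeasure_space_1[OF nu_prob] sets_eq_imp_space_eq[OF nu_sets] by simp

text \<open>\<open>T\<close> gives the complement of \<open>G\<close> no mass from states in
  \<open>G\<close>, so a minorizing measure gives it none either; this keeps the iterates carried by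
  \<open>G\<close>.\<close>

lemma nu_G: "emeasure \<nu> (- G) = 0"
proof -
  obtain y where "y \<in> G" using G_ne by auto
  then have "ennreal \<epsilon> * emeasure \<nu> (- G) = 0"
    using minor[of y "indicator (- G)"] TG[of y] by simp
  then show ?thesis using eps by simp
qed

lemma push_UNIV:
  assumes "carried \<mu>" shows "emeasure (push \<mu> T) UNIV = emeasure \<mu> UNIV"
proof -
  note \<mu> = carriedD[OF assms]
  have "emeasure (push \<mu> T) UNIV = (\<integral>\<^sup>+ y. T (indicator UNIV) y \<partial>\<mu>)"
    by (rule emeasure_push[OF kernel_op_axioms \<mu>(1)]) simp
  also have "\<dots> = (\<integral>\<^sup>+ y. 1 \<partial>\<mu>)"
    using \<mu>(4) T1 by (intro nn_integral_cong_AE) (auto simp: indicator_def[abs_def])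
  finally show ?thesis using \<mu>(2) by simp
qed

lemma push_G:
  assumes "carried \<mu>" shows "emeasure (push \<mu> T) (- G) = 0"
proof -
  note \<mu> = carriedD[OF assms]
  have "emeasure (push \<mu> T) (- G) = (\<integral>\<^sup>+ y. T (indicator (- G)) y \<partial>\<mu>)"
    by (rule emeasure_push[OF kernel_op_axioms \<mu>(1)]) simp
  also have "\<dots> = (\<integral>\<^sup>+ y. 0 \<partial>\<mu>)"
    using \<mu>(4) TG by (intro nn_integral_cong_AE) auto
  finally show ?thesis by simp
qed

lemma carried_doeblin_map:
  assumes \<sigma>: "carried \<sigma>" shows "carried (doeblin_map T \<epsilon> \<nu> \<sigma>)"
proof -
  have "emeasure \<sigma> UNIV + ennreal \<epsilon> * (1 - emeasure \<sigma> UNIV) \<le> emeasure \<sigma> UNIV + 1 * (1 - emeasure \<sigma> UNIV)"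
    using eps_le by (intro add_left_mono mult_right_mono) auto
  also have "\<dots> = 1"
    using carriedD(3)[OF \<sigma>] by (simp add: add_diff_inverse_ennreal)
  finally show ?thesis
    unfolding carried_def using nu_sets nu_UNIV nu_G
    by (simp add: emeasure_doeblin_map push_UNIV[OF \<sigma>] push_G[OF \<sigma>])
qed

fun iter :: "nat \<Rightarrow> 'a measure" where
  "iter 0 = null_measure borel"
| "iter (Suc k) = doeblin_map T \<epsilon> \<nu> (iter k)"

lemma carried_iter: "carried (iter k)"
  by (induction k) (auto simp: carried_def[of "null_measure _"] carried_doeblin_map)

lemma iter_Suc_ge:
  "A \<in> sets borel \<Longrightarrow> emeasure (iter k) A \<le> emeasure (iter (Suc k)) A"
proof (induction k arbitrary: A)
  case (Suc k)
  show ?case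
    using doeblin_map_mono[OF carried_iter carried_iter Suc.IH Suc.prems] by simp
qed simp

text \<open>The mass obeys the recursion \<open>x \<mapsto> x + \<epsilon> (1 - x)\<close>, because
  \<open>T\<close> preserves the mass of measures carried by \<open>G\<close>.\<close>

lemma iter_UNIV: "emeasure (iter k) UNIV = ennreal (1 - (1 - \<epsilon>) ^ k)"
proof (induction k)
  case (Suc k)
  have p: "0 \<le> 1 - (1 - \<epsilon>) ^ k" "0 \<le> (1 - \<epsilon>) ^ k"
    using eps eps_le by (auto intro!: power_le_one)
  have "emeasure (iter (Suc k)) UNIV = ennreal (1 - (1 - \<epsilon>) ^ k) + ennreal \<epsilon> * (1 - ennreal (1 - (1 - \<epsilon>) ^ k))"
    using nu_sets nu_UNIV by (simp add: emeasure_doeblin_map push_UNIV[OF carried_iter] Suc)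
  also have "\<dots> = ennreal (1 - (1 - \<epsilon>) ^ k + \<epsilon> * (1 - \<epsilon>) ^ k)"
    using p eps by (simp add: ennreal_1[symmetric] ennreal_minus ennreal_mult' del: ennreal_1)
  finally show ?case by (simp add: algebra_simps)
qed simp

definition inv_dist :: "'a measure" where
  "inv_dist = measure_of UNIV (sets borel) (\<lambda>A. SUP k. emeasure (iter k) A)"

lemma sets_inv_dist: "sets inv_dist = sets borel"
  using sets.sigma_sets_eq[of borel] by (simp add: inv_dist_def)

text \<open>The iterates increase setwise, so countable sums and suprema can be exchanged.\<close>

lemma emeasure_inv_dist:
  assumes "A \<in> sets borel" shows "emeasure inv_dist A = (SUP k. emeasure (iter k) A)"
  unfolding inv_dist_def
proof (rule emeasure_measure_of_borel[OF _ _ assms])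
  fix F :: "nat \<Rightarrow> 'a set" assume F: "range F \<subseteq> sets borel" "disjoint_family F"
  have "(\<Sum>i. SUP k. emeasure (iter k) (F i)) = (SUP k. \<Sum>i. emeasure (iter k) (F i))"
    using F by (intro ennreal_suminf_SUP_eq incseq_SucI iter_Suc_ge) auto
  also have "\<dots> = (SUP k. emeasure (iter k) (\<Union>i. F i))"
    using F carriedD(1)[OF carried_iter] by (simp add: suminf_emeasure)
  finally show "(\<Sum>i. SUP k. emeasure (iter k) (F i)) = (SUP k. emeasure (iter k) (\<Union>i. F i))" .
qed simp

lemma inv_dist_UNIV: "emeasure inv_dist UNIV = 1"
proof -
  have "(\<lambda>k. ennreal (1 - (1 - \<epsilon>) ^ k)) \<longlonglongrightarrow> ennreal (1 - 0)"
    using eps eps_le by (intro tendsto_ennrealI tendsto_intros LIMSEQ_power_zero) auto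
  moreover have "(\<lambda>k. ennreal (1 - (1 - \<epsilon>) ^ k)) \<longlonglongrightarrow> (SUP k. emeasure (iter k) UNIV)"
    using iter_Suc_ge[of UNIV] unfolding iter_UNIV[symmetric] 
    by (intro LIMSEQ_SUP incseq_SucI) auto
  ultimately show ?thesis
    using LIMSEQ_unique by (fastforce simp: emeasure_inv_dist)
qed

lemma carried_inv_dist: "carried inv_dist"
  using carried_iter by (auto simp: carried_def sets_inv_dist emeasure_inv_dist inv_dist_UNIV)

lemma doeblin_map_eq_push:
  assumes "carried p" "emeasure p UNIV = 1"
  shows "doeblin_map T \<epsilon> \<nu> p = push p T"
  using nu_sets assms(2) by (intro measure_eqI) (auto simp: emeasure_doeblin_map)

text \<open>By monotonicity each iterate lies below the image of the limit, which is the pushed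
  measure. This gives one inequality; equality of masses then takes the place of a continuity
  argument.\<close>

lemma push_inv_dist: "push inv_dist T = inv_dist"
proof (rule setwise_le_imp_eq[symmetric])
  fix A assume A: "A \<in> sets (borel :: 'a measure)"
  have "emeasure (iter (Suc k)) A \<le> emeasure (push inv_dist T) A" for k
    unfolding doeblin_map_eq_push[OF carried_inv_dist inv_dist_UNIV, symmetric] iter.simps
    by (rule doeblin_map_mono[OF carried_iter carried_inv_dist _ A]) (auto simp: emeasure_inv_dist intro: SUP_upper)
  then show "emeasure inv_dist A \<le> emeasure (push inv_dist T) A"
    unfolding emeasure_inv_dist[OF A] using iter_Suc_ge[OF A] by (meson SUP_least order_trans)
qed (auto simp: sets_inv_dist inv_dist_UNIV push_UNIV[OF carried_inv_dist])

text \<open>An invariant law is a fixed point of the monotone map, and induction from zero keeps all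
  iterates below it; equal masses again force equality.\<close>

lemma unique:
  assumes "carried p" "emeasure p UNIV = 1" "push p T = p"
  shows "p = inv_dist"
proof (rule setwise_le_imp_eq[symmetric])
  have *: "emeasure (iter k) A \<le> emeasure p A" if "A \<in> sets borel" for k A
    using that
  proof (induction k arbitrary: A)
    case (Suc k)
    then show ?case
      using doeblin_map_mono[OF carried_iter assms(1) Suc.IH Suc.prems] by (simp add: doeblin_map_eq_push assms)
  qed simp
  show "emeasure inv_dist A \<le> emeasure p A" if "A \<in> sets borel" for A
    using *[OF that] by (simp add: emeasure_inv_dist that SUP_least)
qed (use assms in \<open>auto simp: sets_inv_dist inv_dist_UNIV carried_def\<close>)

end

section \<open>The jump semigroup\<close>

lemma kernel_op_mult:
  assumes "kernel_op T" and [measurable]: "c \<in> borel_measurable borel"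
  shows "kernel_op (\<lambda>f y. c y * T f y)"
proof -
  interpret kernel_op T by fact
  note meas[measurable]
  show ?thesis
    by standard (simp_all add: add cmult SUP algebra_simps SUP_mult_left_ennreal)
qed

lemma kernel_op_add:
  assumes "kernel_op S" "kernel_op T"
  shows "kernel_op (\<lambda>f y. S f y + T f y)"
proof -
  interpret S: kernel_op S by fact
  interpret T: kernel_op T by fact
  note S.meas[measurable] T.meas[measurable]
  show ?thesis
  proof
    fix F :: "nat \<Rightarrow> 'a \<Rightarrow> ennreal" and y 
    assume F: "\<And>i. F i \<in> borel_measurable borel" "incseq F"
    then have "incseq (\<lambda>i. S (F i) y)" "incseq (\<lambda>i. T (F i) y)"
      by (auto simp: incseq_def le_fun_def intro!: S.mono T.mono)
    with F show "S (\<lambda>x. SUP i. F i x) y + T (\<lambda>x. SUP i. F i x) y = (SUP i. S (F i) y + T (F i) y)"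
      by (simp add: S.SUP T.SUP ennreal_SUP_add)
  qed (simp_all add: S.add T.add S.cmult T.cmult algebra_simps)
qed

lemma kernel_op_sum:
  fixes T :: "'i \<Rightarrow> ('a::topological_space \<Rightarrow> ennreal) \<Rightarrow> 'a \<Rightarrow> ennreal"
  assumes "\<And>i. i \<in> I \<Longrightarrow> kernel_op (T i)"
  shows "kernel_op (\<lambda>f y. \<Sum>i\<in>I. T i f y)"
proof -
  have zero: "kernel_op (\<lambda>(f :: 'a \<Rightarrow> ennreal) y. 0)"
    by standard auto
  show ?thesis
    using assms by (induction I rule: infinite_finite_induct) (auto simp: zero kernel_op_add)
qed

lemma kernel_op_at_point:
  assumes "\<phi> \<in> borel_measurable borel"
  shows "kernel_op (\<lambda>f y. f (\<phi> y))"
  by standard (use assms in \<open>auto intro: measurable_compose[OF assms]\<close>)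

lemma kernel_op_mix:
  fixes T :: "'s \<Rightarrow> ('a::topological_space \<Rightarrow> ennreal) \<Rightarrow> 'a \<Rightarrow> ennreal"
  assumes T: "\<And>s. kernel_op (T s)" and "sigma_finite_measure N"
    and m: "\<And>f. f \<in> borel_measurable borel \<Longrightarrow> (\<lambda>(y, s). T s f y) \<in> borel_measurable (borel \<Otimes>\<^sub>M N)"
  shows "kernel_op (\<lambda>f y. \<integral>\<^sup>+ s. T s f y \<partial>N)"
proof -
  interpret N: sigma_finite_measure N by fact
  have s: "(\<lambda>s. T s f y) \<in> borel_measurable N" if "f \<in> borel_measurable borel" for f y
    using measurable_compose_Pair1[OF _ m[OF that], of y] by simp
  show ?thesis
  proof
    fix f :: "'a \<Rightarrow> ennreal" assume "f \<in> borel_measurable borel"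
    from m[OF this] show "(\<lambda>y. \<integral>\<^sup>+ s. T s f y \<partial>N) \<in> borel_measurable borel"
      by (rule N.borel_measurable_nn_integral)
  next
    fix F :: "nat \<Rightarrow> 'a \<Rightarrow> ennreal" and y 
    assume F: "\<And>i. F i \<in> borel_measurable borel" "incseq F"
    then have "incseq (\<lambda>i s. T s (F i) y)"
      by (auto simp: incseq_def le_fun_def intro!: kernel_op.mono[OF T])
    with F s show "(\<integral>\<^sup>+ s. T s (\<lambda>x. SUP i. F i x) y \<partial>N) = (SUP i. \<integral>\<^sup>+ s. T s (F i) y \<partial>N)"
      by (simp add: kernel_op.SUP[OF T] nn_integral_monotone_convergence_SUP)
  qed (simp_all add: kernel_op.add[OF T] kernel_op.cmult[OF T] nn_integral_add nn_integral_cmult s)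
qed

lemma suminf_triangle:
  fixes a :: "nat \<Rightarrow> nat \<Rightarrow> ennreal"
  shows "(\<Sum>k. \<Sum>i\<le>k. a i (k - i)) = (\<Sum>i. \<Sum>j. a i j)"
proof -
  \<comment> \<open>Padding with zeros lets both indices range over all of \<open>nat\<close>;
    Tonelli for counting measure then exchanges the sums.\<close>
  have "(\<Sum>k. \<Sum>i\<le>k. a i (k - i)) = (\<Sum>k. \<Sum>i. (if i \<le> k then a i (k - i) else 0))"
    by (intro suminf_cong, subst suminf_finite[where N = "{..k}" for k]) auto
  also have "\<dots> = (\<integral>\<^sup>+ k. (\<Sum>i. (if i \<le> k then a i (k - i) else 0)) \<partial>count_space UNIV)"
    by (simp add: nn_integral_count_space_nat)
  also have "\<dots> = (\<Sum>i. \<Sum>k. (if i \<le> k then a i (k - i) else 0))"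
    by (subst nn_integral_suminf) (auto simp: nn_integral_count_space_nat)
  also have "\<dots> = (\<Sum>i. \<Sum>j. a i j)"
  proof (rule suminf_cong)
    fix i
    show "(\<Sum>k. (if i \<le> k then a i (k - i) else 0)) = (\<Sum>j. a i j)"
      by (subst suminf_offset[of _ i]) auto
  qed
  finally show ?thesis .
qed

text \<open>The case \<open>Suc i = m\<close> is the last particle, whose jumps only shrink the last gap.\<close>

definition gap_jump :: "nat \<Rightarrow> nat \<Rightarrow> real \<Rightarrow> (nat \<Rightarrow> real) \<Rightarrow> nat \<Rightarrow> real" where
  "gap_jump m i u y = (\<lambda>j. y j + y i * u * ((if Suc i < m then unit_vec (Suc i) j else 0) - unit_vec i j))"

definition lead_jump :: "real \<Rightarrow> (nat \<Rightarrow> real) \<Rightarrow> nat \<Rightarrow> real" where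
  "lead_jump z y = (\<lambda>j. y j + z * unit_vec 0 j)"

text \<open>Absorbing the last particle into the sum lets one computation serve all
  followers.\<close>

lemma jump_op_eq:
  assumes "0 < m"
  shows "jump_op m \<theta> g y =
    (\<Sum>i<m. ennreal (y i) * (\<integral>\<^sup>+ u. indicator {0..1} u * g (gap_jump m i u y) \<partial>lborel))
    + (\<integral>\<^sup>+ z. g (lead_jump z y) \<partial>\<theta>)"
proof -
  obtain k where k: "m = Suc k" using assms by (cases m) auto
  have "(\<lambda>j. y j - y k * u * unit_vec k j) = gap_jump m k u y" for u
    by (auto simp: gap_jump_def k)
  moreover have "(\<lambda>j. y j + y i * u * (unit_vec (Suc i) j - unit_vec i j)) = gap_jump m i u y"
    if "i < k" for u i
    using that by (auto simp: gap_jump_def k)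
  ultimately show ?thesis
    unfolding jump_op_def lead_jump_def by (simp add: k add.commute)
qed

lemma measurable_apply_coord:
  "(\<lambda>y :: nat \<Rightarrow> real. y i) \<in> borel_measurable borel"
  by (rule measurable_product_coordinates)

lemma measurable_apply_coord':
  "g \<in> borel_measurable M \<Longrightarrow> (\<lambda>x. (g x :: nat \<Rightarrow> real) i) \<in> borel_measurable M"
  by (rule measurable_compose[OF _ measurable_apply_coord])

lemma measurable_gap_jump [measurable]:
  assumes [measurable]: "h \<in> borel_measurable M" "g \<in> borel_measurable M"
  shows "(\<lambda>x. gap_jump m i (h x) (g x)) \<in> borel_measurable M"
proof -
  have [measurable]: "(\<lambda>x. g x j) \<in> borel_measurable M" for j
    by (rule measurable_apply_coord'[OF assms(2)])
  show ?thesis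
    unfolding gap_jump_def by (rule measurable_coordinatewise_then_product) measurable
qed

lemma measurable_lead_jump [measurable]:
  assumes [measurable]: "h \<in> borel_measurable M" "g \<in> borel_measurable M"
  shows "(\<lambda>x. lead_jump (h x) (g x)) \<in> borel_measurable M"
proof -
  have [measurable]: "(\<lambda>x. g x j) \<in> borel_measurable M" for j
    by (rule measurable_apply_coord'[OF assms(2)])
  show ?thesis
    unfolding lead_jump_def by (rule measurable_coordinatewise_then_product) measurable
qed

lemma measurable_total_rate [measurable]: "total_rate m \<in> borel_measurable borel"
  unfolding total_rate_def
  by (intro borel_measurable_add borel_measurable_sum measurable_apply_coord borel_measurable_const)

lemma nn_integral_exp_Ici:
  assumes "0 < c"
  shows "(\<integral>\<^sup>+ s. indicator {0..} s * ennreal (exp (- (c * s))) \<partial>lborel) = ennreal (1 / c)"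
proof -
  have "(\<integral>\<^sup>+ s. ennreal (exp (- (c * s))) * indicator {0..} s \<partial>lborel) = ennreal (0 - (- exp (- (c * 0)) / c))"
  proof (rule nn_integral_FTC_atLeast)
    show "((\<lambda>s. - exp (- (c * s)) / c) \<longlongrightarrow> 0) at_top"
      using assms by real_asymp
  qed (use assms in \<open>auto intro!: derivative_eq_intros\<close>)
  then show ?thesis by (simp add: mult.commute)
qed

lemma gap_space_borel [measurable]: "gap_space m \<in> sets borel"
proof -
  have [measurable]: "(\<lambda>y :: nat \<Rightarrow> real. y i) \<in> borel_measurable borel" for i
    by (rule measurable_apply_coord)
  have "{y \<in> space borel. (\<forall>i\<in>{..<m}. 0 \<le> y i) \<and> (\<forall>i\<in>{m..}. y i = 0)} \<in> sets (borel :: (nat \<Rightarrow> real) measure)"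
    by (intro sets.sets_Collect_conj sets.sets_Collect_countable_Ball) auto
  then show ?thesis by (simp add: gap_space_def Ball_def)
qed

section \<open>Transition functions of the gap process\<close>

locale ftl =
  fixes m :: nat and \<theta> :: "real measure"
  assumes m_pos: "0 < m" and theta_prob: "prob_space \<theta>" and theta_sets [measurable_cong]: "sets \<theta> = sets borel"
    and theta_pos: "AE z in \<theta>. 0 < z"
    and theta_int: "integrable \<theta> (\<lambda>z. z)" and theta_mean: "(\<integral>z. z \<partial>\<theta>) = 1"
begin

sublocale theta: prob_space \<theta> by (rule theta_prob)

abbreviation J where "J \<equiv> jump_op m \<theta>"
abbreviation q where "q \<equiv> total_rate m"
abbreviation G where "G \<equiv> gap_space m"
abbreviation P where "P t \<equiv> trans m \<theta> t"
abbreviation Pk where "Pk k t \<equiv> trans_k k m \<theta> t"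

lemmas J_eq = jump_op_eq[OF m_pos, of \<theta>]

text \<open>In the recursion of \<open>trans_k\<close> the jump operator acts on functions of the
  remaining time, and the integral over the jump time needs joint measurability.\<close>

lemma measurable_J_param:
  assumes [measurable]: "(\<lambda>(p, z). g p z) \<in> borel_measurable (N \<Otimes>\<^sub>M borel)"
  shows "(\<lambda>(p, y). J (g p) y) \<in> borel_measurable (N \<Otimes>\<^sub>M borel)"
proof -
  have [measurable]: "(\<lambda>x. ennreal (snd x i)) \<in> borel_measurable (N \<Otimes>\<^sub>M (borel :: (nat \<Rightarrow> real) measure))" for i
    by (rule measurable_compose[OF measurable_apply_coord'[OF measurable_snd] measurable_ennreal])
  show ?thesis
    unfolding J_eq case_prod_beta by measurable
qed

lemma kernel_J: "kernel_op J"
proof -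
  have "kernel_op (\<lambda>f y. \<integral>\<^sup>+ u. indicator {0..1} u * f (gap_jump m i u y) \<partial>lborel)" for i
    by (rule kernel_op_mix) (auto intro!: kernel_op_mult kernel_op_at_point sigma_finite_lborel)
  moreover have "kernel_op (\<lambda>f y. \<integral>\<^sup>+ z. f (lead_jump z y) \<partial>\<theta>)"
    by (rule kernel_op_mix) (auto intro!: kernel_op_at_point theta.sigma_finite_measure_axioms)
  ultimately have "kernel_op (\<lambda>f y. (\<Sum>i<m. ennreal (y i) * (\<integral>\<^sup>+ u. indicator {0..1} u * f (gap_jump m i u y) \<partial>lborel))
    + (\<integral>\<^sup>+ z. f (lead_jump z y) \<partial>\<theta>))"
    by (intro kernel_op_add kernel_op_sum kernel_op_mult measurable_compose[OF measurable_apply_coord measurable_ennreal]) auto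
  then show ?thesis by (simp add: J_eq[abs_def])
qed

sublocale J: kernel_op J by (rule kernel_J)

lemma measurable_Pk_joint:
  assumes f: "f \<in> borel_measurable borel"
  shows "(\<lambda>(t, y). Pk k t f y) \<in> borel_measurable (borel \<Otimes>\<^sub>M borel)"
proof (induction k)
  case 0
  then show ?case using f by simp
next
  case (Suc k)
  note [measurable] = measurable_J_param[OF Suc]
  \<comment> \<open>As a condition on the pair \<open>(s, t)\<close>, the indicator with moving
    endpoint is visibly jointly measurable.\<close>
  have i: "indicator {0..t} s = (if 0 \<le> s \<and> s \<le> t then 1 else 0 :: ennreal)" for s t :: real
    by auto
  show ?case unfolding trans_k.simps i by measurable
qed

lemma measurable_Pk [measurable]:
  assumes "f \<in> borel_measurable borel" "g \<in> borel_measurable M" "h \<in> borel_measurable M"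
  shows "(\<lambda>x. Pk k (g x) f (h x)) \<in> borel_measurable M"
  using measurable_compose[OF measurable_Pair[OF assms(2,3)] measurable_Pk_joint[OF assms(1), of k]] by simp

lemma measurable_J_Pk [measurable]:
  assumes "f \<in> borel_measurable borel" "g \<in> borel_measurable M" "h \<in> borel_measurable M"
  shows "(\<lambda>x. J (\<lambda>z. Pk k (g x) f z) (h x)) \<in> borel_measurable M"
  using measurable_compose[OF measurable_Pair[OF assms(2,3)] measurable_J_param[OF measurable_Pk_joint[OF assms(1), of k]]] by simp

lemma kernel_Pk: "kernel_op (Pk k t)"
proof (induction k arbitrary: t)
  case 0
  show ?case
    using kernel_op_mult[OF kernel_op_at_point[of "\<lambda>y. y"], of "\<lambda>y. ennreal (exp (- q y * t))"] by simp
next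
  case (Suc k)
  have "kernel_op (\<lambda>f y. \<integral>\<^sup>+ s. indicator {0..t} s * ennreal (exp (- q y * s)) *
             J (\<lambda>z. Pk k (t - s) f z) y \<partial>lborel)"
    by (rule kernel_op_mix)
       (auto intro!: kernel_op_mult kernel_op_comp[OF kernel_J Suc] sigma_finite_lborel)
  then show ?case by simp
qed

lemma kernel_P: "kernel_op (P t)"
  unfolding trans_def[abs_def] by (rule kernel_op_suminf) (rule kernel_Pk)

lemma measurable_P [measurable]:
  assumes "f \<in> borel_measurable borel" "g \<in> borel_measurable M" "h \<in> borel_measurable M"
  shows "(\<lambda>x. P (g x) f (h x)) \<in> borel_measurable M"
  unfolding trans_def using assms by measurable

text \<open>Chapman-Kolmogorov, refined by the number of jumps up to \<open>t\<close>. If the first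
  jump time \<open>u\<close> is before \<open>t\<close>, the induction hypothesis applies to the
  remaining time \<open>t - u\<close>; otherwise the exponential clock starts afresh at
  \<open>t\<close>.\<close>

lemma Pk_add:
  assumes [measurable]: "f \<in> borel_measurable borel" and "0 \<le> s" "0 \<le> t"
  shows "Pk k (t + s) f y = (\<Sum>i\<le>k. Pk i t (Pk (k - i) s f) y)"
  using \<open>0 \<le> t\<close>
proof (induction k arbitrary: t y)
  case 0
  show ?case by (simp add: algebra_simps exp_diff exp_minus divide_inverse flip: ennreal_mult'' mult.assoc)
next
  case (Suc k)
  let ?e = "\<lambda>u. ennreal (exp (- q y * u))"
  let ?h = "\<lambda>u. J (\<lambda>z. Pk k (t + s - u) f z) y"
  have h [measurable]: "?h \<in> borel_measurable borel"
    by (rule measurable_J_Pk) measurable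
  \<comment> \<open>Both closed intervals contain \<open>t\<close>, so the splitting may fail only
    at this null point.\<close>
  have split: "indicator {0..t + s} u * ?e u * ?h u =
      indicator {0..t} u * ?e u * ?h u + indicator {t..t + s} u * ?e u * ?h u" if "u \<noteq> t" for u
    using that \<open>0 \<le> s\<close> \<open>0 \<le> t\<close> by (auto simp: indicator_def)
  have "Pk (Suc k) (t + s) f y = (\<integral>\<^sup>+ u. indicator {0..t} u * ?e u * ?h u + indicator {t..t + s} u * ?e u * ?h u \<partial>lborel)"
    unfolding trans_k.simps by (intro nn_integral_cong_AE eventually_mono[OF AE_lborel_singleton[of t]] split)
  also have "\<dots> = (\<integral>\<^sup>+ u. indicator {0..t} u * ?e u * ?h u \<partial>lborel) + (\<integral>\<^sup>+ u. indicator {t..t + s} u * ?e u * ?h u \<partial>lborel)"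
    by (rule nn_integral_add) measurable
  also have "(\<integral>\<^sup>+ u. indicator {t..t + s} u * ?e u * ?h u \<partial>lborel) =
      (\<integral>\<^sup>+ u. indicator {t..t + s} (t + 1 * u) * ?e (t + 1 * u) * ?h (t + 1 * u) \<partial>lborel)"
    by (subst nn_integral_real_affine[where c = 1 and t = t]) simp_all
  \<comment> \<open>Lack of memory: after the shift the factor for survival up to \<open>t\<close>
    splits off.\<close>
  also have "\<dots> = (\<integral>\<^sup>+ u. ?e t * (indicator {0..s} u * ?e u * J (\<lambda>z. Pk k (s - u) f z) y) \<partial>lborel)"
    by (intro nn_integral_cong)
       (auto simp: algebra_simps exp_diff exp_minus divide_inverse ennreal_mult' split: split_indicator)
  also have "\<dots> = ?e t * Pk (Suc k) s f y"
    by (simp add: nn_integral_cmult)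
  also have "\<dots> = Pk 0 t (Pk (Suc k - 0) s f) y" by simp
  also have "(\<integral>\<^sup>+ u. indicator {0..t} u * ?e u * ?h u \<partial>lborel) =
      (\<integral>\<^sup>+ u. (\<Sum>i\<le>k. indicator {0..t} u * ?e u * J (Pk i (t - u) (Pk (k - i) s f)) y) \<partial>lborel)"
  proof (rule nn_integral_cong)
    fix u
    have "?h u = (\<Sum>i\<le>k. J (Pk i (t - u) (Pk (k - i) s f)) y)" if "u \<le> t"
    proof -
      have "(\<lambda>z. Pk k (t + s - u) f z) = (\<lambda>z. \<Sum>i\<le>k. Pk i (t - u) (Pk (k - i) s f) z)"
        using Suc.IH[of "t - u"] that by (auto simp: algebra_simps)
      then show ?thesis by (simp add: J.sum)
    qed
    then show "indicator {0..t} u * ?e u * ?h u = (\<Sum>i\<le>k. indicator {0..t} u * ?e u * J (Pk i (t - u) (Pk (k - i) s f)) y)"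
      by (auto simp: sum_distrib_left split: split_indicator)
  qed
  also have "\<dots> = (\<Sum>i\<le>k. Pk (Suc i) t (Pk (Suc k - Suc i) s f) y)"
    by (subst nn_integral_sum) auto
  finally show ?case
    by (simp only: sum.atMost_Suc_shift add.commute)
qed

lemma P_add:
  assumes [measurable]: "f \<in> borel_measurable borel" and "0 \<le> s" "0 \<le> t"
  shows "P (t + s) f y = P t (P s f) y"
proof -
  have "P t (P s f) y = (\<Sum>i. \<Sum>j. Pk i t (Pk j s f) y)"
    unfolding trans_def by (intro suminf_cong kernel_op.suminf[OF kernel_Pk]) measurable
  also have "\<dots> = P (t + s) f y"
    unfolding trans_def using assms(2,3) by (subst suminf_triangle[symmetric]) (simp add: Pk_add)
  finally show ?thesis by simp
qed

section \<open>Confinement to the gap space\<close>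

lemma G_D: "y \<in> G \<Longrightarrow> 0 \<le> y i" "y \<in> G \<Longrightarrow> m \<le> i \<Longrightarrow> y i = 0"
  by (cases "i < m"; auto simp: gap_space_def)+

lemma gap_jump_G:
  assumes "y \<in> G" "0 \<le> u" "u \<le> 1" "i < m" shows "gap_jump m i u y \<in> G"
proof -
  have "y i * u \<le> y i" "0 \<le> y i * u"
    using G_D(1)[OF assms(1), of i] assms by (auto intro: mult_right_le_one_le)
  then have "0 \<le> gap_jump m i u y j" for j
    using G_D(1)[OF assms(1), of j] by (auto simp: gap_jump_def unit_vec_def)
  moreover have "gap_jump m i u y j = 0" if "m \<le> j" for j
    using G_D(2)[OF assms(1) that] that assms(4) by (auto simp: gap_jump_def unit_vec_def)
  ultimately show ?thesis by (simp add: gap_space_def)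
qed

lemma lead_jump_G: "y \<in> G \<Longrightarrow> 0 \<le> z \<Longrightarrow> lead_jump z y \<in> G"
  using m_pos by (auto simp: gap_space_def lead_jump_def unit_vec_def)

lemma AE_lead_jump_G: "y \<in> G \<Longrightarrow> AE z in \<theta>. lead_jump z y \<in> G"
  using theta_pos by eventually_elim (auto intro: lead_jump_G)

lemma q_G: "y \<in> G \<Longrightarrow> 1 \<le> q y"
  by (auto simp: total_rate_def G_D intro!: sum_nonneg)

text \<open>Jumps from \<open>G\<close> land in \<open>G\<close> almost surely, so comparison on
  \<open>G\<close> suffices. Later drift estimates may therefore assume nonnegative gaps.\<close>

lemma J_mono_G:
  assumes y: "y \<in> G" and le: "\<And>x. x \<in> G \<Longrightarrow> f x \<le> g x"
  shows "J f y \<le> J g y"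
  unfolding J_eq
proof (intro add_mono sum_mono mult_left_mono nn_integral_mono_AE)
  show "AE z in \<theta>. f (lead_jump z y) \<le> g (lead_jump z y)"
    using AE_lead_jump_G[OF y] by eventually_elim (rule le)
qed (use y le gap_jump_G in \<open>auto split: split_indicator\<close>)

lemma J_cong_G:
  assumes "y \<in> G" and "\<And>x. x \<in> G \<Longrightarrow> f x = g x"
  shows "J f y = J g y"
  using assms by (intro antisym J_mono_G) auto

lemma J_one: "y \<in> G \<Longrightarrow> J (\<lambda>_. 1) y = ennreal (q y)"
  unfolding J_eq
  by (simp add: total_rate_def G_D sum_nonneg theta.emeasure_space_1)

lemma J_one_finite: "J (\<lambda>_. 1) y < \<top>"
  unfolding J_eq by (simp add: theta.emeasure_space_1 less_top[symmetric])

section \<open>The resolvent\<close>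

text \<open>On \<open>G\<close> this is the Laplace transform at 1 of the survival function
  \<open>exp (- q y * t)\<close> of the holding time.\<close>

definition r :: "(nat \<Rightarrow> real) \<Rightarrow> ennreal" where "r y = ennreal (1 / (q y + 1))"

text \<open>One step of the embedded jump chain killed by an independent unit exponential clock:
  from \<open>G\<close> a jump precedes the killing with probability
  \<open>q / (q + 1)\<close>.\<close>

definition A :: "((nat \<Rightarrow> real) \<Rightarrow> ennreal) \<Rightarrow> (nat \<Rightarrow> real) \<Rightarrow> ennreal" where
  "A f y = r y * J f y"

text \<open>The \<open>k\<close>-th term is the discounted contribution of the sojourn after exactly
  \<open>k\<close> jumps. Agreement with the Laplace transform of the semigroup on \<open>G\<close>
  is \<open>laplace_P\<close>.\<close>

definition R :: "((nat \<Rightarrow> real) \<Rightarrow> ennreal) \<Rightarrow> (nat \<Rightarrow> real) \<Rightarrow> ennreal" where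
  "R f y = (\<Sum>k. (A ^^ k) (\<lambda>x. r x * f x) y)"

lemma measurable_r [measurable]: "r \<in> borel_measurable borel"
  unfolding r_def[abs_def] by measurable

lemma kernel_A: "kernel_op A"
  unfolding A_def[abs_def] by (rule kernel_op_mult[OF kernel_J]) measurable

sublocale A: kernel_op A by (rule kernel_A)

lemma kernel_Apow: "kernel_op (A ^^ k)"
proof (induction k)
  case 0
  show ?case using kernel_op_at_point[of "\<lambda>y. y"] by (simp add: id_def)
next
  case (Suc k)
  show ?case using kernel_op_comp[OF kernel_A Suc] by (simp add: o_def)
qed

lemma kernel_R: "kernel_op R"
proof -
  have "kernel_op (\<lambda>f y. r y * f y)"
    using kernel_op_mult[OF kernel_op_at_point[of "\<lambda>y. y"], of r] by simp
  then show ?thesis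
    unfolding R_def[abs_def] by (intro kernel_op_suminf kernel_op_comp[OF kernel_Apow])
qed

sublocale R: kernel_op R by (rule kernel_R)

lemma measurable_Apow [measurable]: "f \<in> borel_measurable borel \<Longrightarrow> (A ^^ k) f \<in> borel_measurable borel"
  by (rule kernel_op.meas[OF kernel_Apow])

declare A.meas [measurable] R.meas [measurable] J.meas [measurable]

lemma Apow_mono_G:
  assumes le: "\<And>x. x \<in> G \<Longrightarrow> f x \<le> g x"
  shows "y \<in> G \<Longrightarrow> (A ^^ k) f y \<le> (A ^^ k) g y"
proof (induction k arbitrary: y)
  case (Suc k)
  have "J ((A ^^ k) f) y \<le> J ((A ^^ k) g) y"
    by (rule J_mono_G[OF Suc.prems Suc.IH])
  then show ?case
    by (simp only: funpow.simps o_apply A_def[of "(A ^^ k) _"] mult_left_mono zero_le)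
qed (use le in simp)

lemma R_mono_G:
  assumes "y \<in> G" and le: "\<And>x. x \<in> G \<Longrightarrow> f x \<le> g x"
  shows "R f y \<le> R g y"
  unfolding R_def using assms by (intro suminf_le Apow_mono_G mult_left_mono) auto

lemma R_cong_G:
  assumes "y \<in> G" and "\<And>x. x \<in> G \<Longrightarrow> f x = g x"
  shows "R f y = R g y"
  using assms by (intro antisym R_mono_G) auto

lemma R_unfold:
  assumes [measurable]: "f \<in> borel_measurable borel"
  shows "R f y = r y * f y + A (R f) y"
proof -
  have "A (R f) y = A (\<lambda>x. \<Sum>k. (A ^^ k) (\<lambda>x. r x * f x) x) y"
    by (simp add: R_def[abs_def])
  also have "\<dots> = (\<Sum>k. A ((A ^^ k) (\<lambda>x. r x * f x)) y)"
    by (rule A.suminf) measurable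
  finally have *: "A (R f) y = (\<Sum>k. A ((A ^^ k) (\<lambda>x. r x * f x)) y)" .
  have "R f y = (\<Sum>k. (A ^^ (k + 1)) (\<lambda>x. r x * f x) y) + (\<Sum>k<1. (A ^^ k) (\<lambda>x. r x * f x) y)"
    unfolding R_def by (rule suminf_offset) simp
  then show ?thesis
    by (simp add: * add.commute)
qed

text \<open>The recursion of \<open>trans_k\<close> is a convolution in time, which the Laplace
  transform turns into \<open>r y\<close> times the transform of what follows the jump.\<close>

lemma laplace_Pk:
  assumes [measurable]: "f \<in> borel_measurable borel" and "y \<in> G"
  shows "(\<integral>\<^sup>+ t. indicator {0..} t * ennreal (exp (- t)) * Pk k t f y \<partial>lborel) = (A ^^ k) (\<lambda>x. r x * f x) y"
  using \<open>y \<in> G\<close>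
proof (induction k arbitrary: y)
  case 0
  have "(\<integral>\<^sup>+ t. indicator {0..} t * ennreal (exp (- t)) * Pk 0 t f y \<partial>lborel)
      = (\<integral>\<^sup>+ t. (indicator {0..} t * ennreal (exp (- ((q y + 1) * t)))) * f y \<partial>lborel)"
    by (intro nn_integral_cong) (auto simp: algebra_simps exp_diff exp_minus divide_inverse ennreal_mult')
  also have "\<dots> = r y * f y"
    using q_G[OF 0] by (simp add: nn_integral_multc nn_integral_exp_Ici r_def)
  finally show ?case by simp
next
  case (Suc k)
  let ?J = "\<lambda>t. J (\<lambda>z. Pk k t f z) y"
  let ?L = "\<integral>\<^sup>+ t. indicator {0..} t * ennreal (exp (- t)) * ?J t \<partial>lborel"
  have i: "indicator {0..t} s = (if 0 \<le> s \<and> s \<le> t then 1 else 0 :: ennreal)" for s t :: real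
    by auto
  have [measurable]: "?J \<in> borel_measurable borel"
    by (rule measurable_J_Pk) measurable
  have "(\<integral>\<^sup>+ t. indicator {0..} t * ennreal (exp (- t)) * Pk (Suc k) t f y \<partial>lborel) =
     (\<integral>\<^sup>+ t. (\<integral>\<^sup>+ s. indicator {0..} t * ennreal (exp (- t)) *
        (indicator {0..t} s * ennreal (exp (- q y * s)) * ?J (t - s)) \<partial>lborel) \<partial>lborel)"
    by (subst nn_integral_cmult) auto
  also have "\<dots> = (\<integral>\<^sup>+ s. (\<integral>\<^sup>+ t. indicator {0..} t * ennreal (exp (- t)) *
        (indicator {0..t} s * ennreal (exp (- q y * s)) * ?J (t - s)) \<partial>lborel) \<partial>lborel)"
    unfolding i by (rule lborel_pair.Fubini') measurable
  also have "\<dots> = (\<integral>\<^sup>+ s. (indicator {0..} s * ennreal (exp (- ((q y + 1) * s)))) * ?L \<partial>lborel)"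
  proof (rule nn_integral_cong)
    fix s :: real
    have "(\<integral>\<^sup>+ t. indicator {0..} t * ennreal (exp (- t)) *
        (indicator {0..t} s * ennreal (exp (- q y * s)) * ?J (t - s)) \<partial>lborel) =
      (\<integral>\<^sup>+ t. indicator {0..} (s + 1 * t) * ennreal (exp (- (s + 1 * t))) *
        (indicator {0..s + 1 * t} s * ennreal (exp (- q y * s)) * ?J (s + 1 * t - s)) \<partial>lborel)"
      \<comment> \<open>Passing to the time elapsed since the first jump decouples the two
        integrals.\<close>
      unfolding i by (subst nn_integral_real_affine[where c = 1 and t = s]) simp_all
    also have "\<dots> = (\<integral>\<^sup>+ t. (indicator {0..} s * ennreal (exp (- ((q y + 1) * s)))) *
        (indicator {0..} t * ennreal (exp (- t)) * ?J t) \<partial>lborel)"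
      by (intro nn_integral_cong)
        (auto simp: algebra_simps exp_diff exp_minus divide_inverse ennreal_mult' split: split_indicator)
    also have "\<dots> = (indicator {0..} s * ennreal (exp (- ((q y + 1) * s)))) * ?L"
      by (rule nn_integral_cmult) measurable
    finally show "(\<integral>\<^sup>+ t. indicator {0..} t * ennreal (exp (- t)) *
        (indicator {0..t} s * ennreal (exp (- q y * s)) * ?J (t - s)) \<partial>lborel) = 
        (indicator {0..} s * ennreal (exp (- ((q y + 1) * s)))) * ?L" .
  qed
  also have "\<dots> = r y * ?L"
    using q_G[OF Suc.prems] by (simp add: nn_integral_multc nn_integral_exp_Ici r_def)
  \<comment> \<open>The time integral is moved inside \<open>J\<close>, where the induction
    hypothesis applies at each state of \<open>G\<close>.\<close>
  also have "?L = (\<integral>\<^sup>+ t. J (\<lambda>z. indicator {0..} t * ennreal (exp (- t)) * Pk k t f z) y \<partial>lborel)"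
    by (simp add: J.cmult)
  also have "\<dots> = J (\<lambda>z. \<integral>\<^sup>+ t. indicator {0..} t * ennreal (exp (- t)) * Pk k t f z \<partial>lborel) y"
    by (rule kernel_op_nn_integral[OF kernel_J J_one_finite sigma_finite_lborel, symmetric]) measurable
  also have "\<dots> = J ((A ^^ k) (\<lambda>x. r x * f x)) y"
    by (rule J_cong_G[OF Suc.prems Suc.IH])
  finally show ?case
    by (simp only: funpow.simps o_apply A_def[of "(A ^^ k) _"])
qed

lemma laplace_P:
  assumes [measurable]: "f \<in> borel_measurable borel" and "y \<in> G"
  shows "(\<integral>\<^sup>+ t. indicator {0..} t * ennreal (exp (- t)) * P t f y \<partial>lborel) = R f y"
  unfolding R_def laplace_Pk[OF assms, symmetric] trans_def
  by (subst nn_integral_suminf[symmetric]) auto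

text \<open>Discrete Dynkin argument: if each step of the killed chain loses at least
  \<open>\<psi>\<close> from \<open>\<phi>\<close>, the losses telescope.\<close>

lemma Apow_le:
  assumes [measurable]: "\<phi> \<in> borel_measurable borel" "\<psi> \<in> borel_measurable borel"
    and le: "\<And>x. x \<in> G \<Longrightarrow> A \<phi> x + \<psi> x \<le> \<phi> x" and y: "y \<in> G"
  shows "(A ^^ K) \<phi> y + (\<Sum>k<K. (A ^^ k) \<psi> y) \<le> \<phi> y"
proof (induction K)
  case (Suc K)
  have "(A ^^ Suc K) \<phi> y + (A ^^ K) \<psi> y = (A ^^ K) (\<lambda>x. A \<phi> x + \<psi> x) y"
    by (simp add: kernel_op.add[OF kernel_Apow] funpow_swap1)
  also have "\<dots> \<le> (A ^^ K) \<phi> y"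
    by (rule Apow_mono_G[OF le y])
  finally have *: "(A ^^ Suc K) \<phi> y + (A ^^ K) \<psi> y \<le> (A ^^ K) \<phi> y" .
  have "(A ^^ Suc K) \<phi> y + (\<Sum>k<Suc K. (A ^^ k) \<psi> y) =
      ((A ^^ Suc K) \<phi> y + (A ^^ K) \<psi> y) + (\<Sum>k<K. (A ^^ k) \<psi> y)"
    by (simp only: sum.lessThan_Suc add_ac)
  also have "\<dots> \<le> (A ^^ K) \<phi> y + (\<Sum>k<K. (A ^^ k) \<psi> y)"
    by (rule add_right_mono[OF *])
  finally show ?case using Suc by (rule order_trans)
qed simp

text \<open>The reverse telescoping. The lower bound \<open>\<psi>1 - \<psi>2\<close> on the drift
  is distributed over both sides, as \<open>ennreal\<close> has no negative values.\<close>

lemma Apow_ge: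
  assumes [measurable]: "\<phi> \<in> borel_measurable borel" "\<psi>1 \<in> borel_measurable borel" "\<psi>2 \<in> borel_measurable borel"
    and le: "\<And>x. x \<in> G \<Longrightarrow> \<phi> x + \<psi>1 x \<le> A \<phi> x + \<psi>2 x" and y: "y \<in> G"
  shows "\<phi> y + (\<Sum>k<K. (A ^^ k) \<psi>1 y) \<le> (A ^^ K) \<phi> y + (\<Sum>k<K. (A ^^ k) \<psi>2 y)"
proof (induction K)
  case (Suc K)
  have "(A ^^ K) \<phi> y + (A ^^ K) \<psi>1 y = (A ^^ K) (\<lambda>x. \<phi> x + \<psi>1 x) y"
    by (simp add: kernel_op.add[OF kernel_Apow])
  also have "\<dots> \<le> (A ^^ K) (\<lambda>x. A \<phi> x + \<psi>2 x) y"
    by (rule Apow_mono_G[OF le y])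
  also have "\<dots> = (A ^^ Suc K) \<phi> y + (A ^^ K) \<psi>2 y"
    by (simp add: kernel_op.add[OF kernel_Apow] funpow_swap1)
  finally have *: "(A ^^ K) \<phi> y + (A ^^ K) \<psi>1 y \<le> (A ^^ Suc K) \<phi> y + (A ^^ K) \<psi>2 y" .
  have "\<phi> y + (\<Sum>k<Suc K. (A ^^ k) \<psi>1 y) = (\<phi> y + (\<Sum>k<K. (A ^^ k) \<psi>1 y)) + (A ^^ K) \<psi>1 y"
    by (simp add: add_ac)
  also have "\<dots> \<le> ((A ^^ K) \<phi> y + (\<Sum>k<K. (A ^^ k) \<psi>2 y)) + (A ^^ K) \<psi>1 y"
    by (rule add_right_mono[OF Suc])
  also have "\<dots> = (\<Sum>k<K. (A ^^ k) \<psi>2 y) + ((A ^^ K) \<phi> y + (A ^^ K) \<psi>1 y)"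
    by (simp only: add_ac)
  also have "\<dots> \<le> (\<Sum>k<K. (A ^^ k) \<psi>2 y) + ((A ^^ Suc K) \<phi> y + (A ^^ K) \<psi>2 y)"
    by (rule add_left_mono[OF *])
  finally show ?case by (simp only: sum.lessThan_Suc add_ac)
qed simp

section \<open>Lyapunov estimates\<close>

text \<open>The sum of the distances of all followers from the leader: gap \<open>j\<close>
  separates \<open>m - j\<close> of them from it.\<close>

definition V :: "(nat \<Rightarrow> real) \<Rightarrow> real" where
  "V y = (\<Sum>j<m. (real m - real j) * y j)"

definition w :: "(nat \<Rightarrow> real) \<Rightarrow> real" where
  "w y = 1 / (1 + V y)"

lemma measurable_V [measurable]: "V \<in> borel_measurable borel"
proof -
  have [measurable]: "(\<lambda>y :: nat \<Rightarrow> real. y i) \<in> borel_measurable borel" for i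
    by (rule measurable_apply_coord)
  show ?thesis unfolding V_def[abs_def] by measurable
qed

lemma measurable_w [measurable]: "w \<in> borel_measurable borel"
  unfolding w_def[abs_def] by measurable

lemma sum_unit_vec: "(\<Sum>j<m. (real m - real j) * unit_vec i j) = (if i < m then real m - real i else 0)"
  by (simp add: unit_vec_def if_distrib cong: if_cong)

lemma V_gap_jump:
  assumes "i < m" shows "V (gap_jump m i u y) = V y - y i * u"
proof -
  have "V (gap_jump m i u y) = V y + y i * u *
      ((if Suc i < m then \<Sum>j<m. (real m - real j) * unit_vec (Suc i) j else 0) - (\<Sum>j<m. (real m - real j) * unit_vec i j))"
    by (simp add: V_def gap_jump_def distrib_left right_diff_distrib sum.distrib sum_subtractf sum_distrib_left
      mult.left_commute)
  \<comment> \<open>This covers the last gap too: its weight is 1, so length that leaves it also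
    lowers \<open>V\<close> by 1 per unit.\<close>
  also have "(if Suc i < m then \<Sum>j<m. (real m - real j) * unit_vec (Suc i) j else 0) - (\<Sum>j<m. (real m - real j) * unit_vec i j) = -1"
    using assms by (cases "Suc i = m") (auto simp: sum_unit_vec)
  finally show ?thesis by simp
qed

lemma V_lead_jump: "V (lead_jump z y) = V y + real m * z"
proof -
  have "V (lead_jump z y) = V y + z * (\<Sum>j<m. (real m - real j) * unit_vec 0 j)"
    by (simp add: V_def lead_jump_def distrib_left sum.distrib sum_distrib_left mult.left_commute)
  then show ?thesis using m_pos by (simp add: sum_unit_vec)
qed

lemma V_G: "y \<in> G \<Longrightarrow> 0 \<le> V y"
  by (auto simp: V_def G_D intro!: sum_nonneg mult_nonneg_nonneg)

lemma sum_le_V: "y \<in> G \<Longrightarrow> (\<Sum>j<m. y j) \<le> V y"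
  unfolding V_def
proof (rule sum_mono)
  fix j assume "y \<in> G" "j \<in> {..<m}"
  then show "y j \<le> (real m - real j) * y j"
    using mult_right_mono[of 1 "real m - real j" "y j"] G_D(1)[of y j] by simp
qed

lemma q_le_V: "y \<in> G \<Longrightarrow> q y \<le> V y + 1"
  using sum_le_V by (simp add: total_rate_def)

lemma V_le_sum: "y \<in> G \<Longrightarrow> V y \<le> real m * (\<Sum>j<m. y j)"
  unfolding V_def sum_distrib_left
  by (auto intro!: sum_mono mult_right_mono simp: G_D)

text \<open>Followers only lower \<open>V\<close>, and a leader jump adds \<open>m\<close> times a
  variable of mean 1. Dropping the quadratic decrease leaves the drift bound
  \<open>m\<close>.\<close>

lemma J_V_le:
  assumes y: "y \<in> G" and "0 \<le> c"
  shows "J (\<lambda>x. ennreal (V x + c)) y \<le> ennreal (q y * (V y + c) + m)"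
proof -
  have Vy: "0 \<le> V y" using V_G[OF y] .
  have gap: "(\<integral>\<^sup>+ u. indicator {0..1} u * ennreal (V (gap_jump m i u y) + c) \<partial>lborel) \<le> ennreal (V y + c)"
    if "i < m" for i
  proof -
    have "(\<integral>\<^sup>+ u. indicator {0..1} u * ennreal (V (gap_jump m i u y) + c) \<partial>lborel)
        \<le> (\<integral>\<^sup>+ u. indicator {0..1::real} u * ennreal (V y + c) \<partial>lborel)"
      by (intro nn_integral_mono) (auto simp: V_gap_jump that G_D(1)[OF y] intro!: ennreal_leI split: split_indicator)
    also have "\<dots> = ennreal (V y + c)" by (simp add: nn_integral_multc)
    finally show ?thesis .
  qed
  have lead: "(\<integral>\<^sup>+ z. ennreal (V (lead_jump z y) + c) \<partial>\<theta>) = ennreal (V y + c + m)"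
  proof -
    have "(\<integral>\<^sup>+ z. ennreal (V (lead_jump z y) + c) \<partial>\<theta>) = ennreal (\<integral>z. V y + c + real m * z \<partial>\<theta>)"
      unfolding V_lead_jump add.assoc add.commute[of _ c]
      using theta_pos theta_int Vy \<open>0 \<le> c\<close> by (intro nn_integral_eq_integral) (auto elim!: eventually_mono)
    also have "(\<integral>z. V y + c + real m * z \<partial>\<theta>) = V y + c + m"
      using theta_int theta_mean by (simp add: theta.prob_space)
    finally show ?thesis .
  qed
  have "J (\<lambda>x. ennreal (V x + c)) y \<le> (\<Sum>i<m. ennreal (y i) * ennreal (V y + c)) + ennreal (V y + c + m)"
    unfolding J_eq lead by (intro add_mono sum_mono mult_left_mono gap) auto
  also have "\<dots> = ennreal ((\<Sum>i<m. y i) * (V y + c) + (V y + c + m))"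
    using Vy \<open>0 \<le> c\<close> G_D(1)[OF y]
    by (simp add: sum_distrib_right[symmetric] ennreal_mult' sum_nonneg)
  finally show ?thesis by (simp add: total_rate_def algebra_simps)
qed

lemma r_mult: "y \<in> G \<Longrightarrow> r y * ennreal c = ennreal (c / (q y + 1))"
  using q_G[of y] by (simp add: r_def ennreal_mult'[symmetric])

text \<open>The series is one plus the expected number of jumps before killing, so its finiteness
  rules out explosion.\<close>

lemma sum_Apow_one_finite:
  assumes y: "y \<in> G"
  shows "(\<Sum>k. (A ^^ k) (\<lambda>_. 1) y) < \<top>"
proof -
  \<comment> \<open>With the constant \<open>m + 1\<close>, one killed step lowers the function by
    at least \<open>(V + 1) / (q + 1)\<close>, and \<open>q \<le> V + 1\<close> makes this at least
    1/2.\<close>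
  let ?\<phi> = "\<lambda>x. ennreal (V x + (real m + 1))"
  have le: "A ?\<phi> x + ennreal (1/2) \<le> ?\<phi> x" if x: "x \<in> G" for x
  proof -
    have qx: "1 \<le> q x" "q x \<le> V x + 1" "0 \<le> V x"
      using q_G[OF x] q_le_V[OF x] V_G[OF x] by auto
    have "A ?\<phi> x \<le> r x * ennreal (q x * (V x + (real m + 1)) + m)"
      unfolding A_def by (intro mult_left_mono J_V_le x) auto
    also have "\<dots> = ennreal ((q x * (V x + (real m + 1)) + m) / (q x + 1))"
      by (rule r_mult[OF x])
    finally have "A ?\<phi> x + ennreal (1/2) \<le> ennreal ((q x * (V x + (real m + 1)) + m) / (q x + 1)) + ennreal (1/2)"
      by (rule add_right_mono)
    also have "\<dots> = ennreal ((q x * (V x + (real m + 1)) + m) / (q x + 1) + 1/2)"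
      using qx by (intro ennreal_plus[symmetric]) auto
    also have "\<dots> \<le> ?\<phi> x"
    proof (rule ennreal_leI)
      have "(q x * (V x + (real m + 1)) + m) / (q x + 1) = V x + (real m + 1) - (V x + 1) / (q x + 1)"
        using qx by (simp add: field_simps)
      moreover have "1/2 \<le> (V x + 1) / (q x + 1)"
        using qx by (simp add: field_simps)
      ultimately show "(q x * (V x + (real m + 1)) + m) / (q x + 1) + 1/2 \<le> V x + (real m + 1)"
        by linarith
    qed
    finally show ?thesis .
  qed
  have "(\<Sum>k<K. (A ^^ k) (\<lambda>_. ennreal (1/2)) y) \<le> ?\<phi> y" for K
    using Apow_le[of ?\<phi> "\<lambda>_. ennreal (1/2)" y K, OF _ _ le y]
    by (rule order_trans[rotated]) (simp_all add: add_increasing)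
  then have "(\<Sum>k. (A ^^ k) (\<lambda>_. ennreal (1/2) * 1) y) \<le> ?\<phi> y"
    unfolding suminf_eq_SUP by (intro SUP_least) simp
  also have "(\<Sum>k. (A ^^ k) (\<lambda>_. ennreal (1/2) * 1) y) = ennreal (1/2) * (\<Sum>k. (A ^^ k) (\<lambda>_. 1) y)"
    by (subst kernel_op.cmult[OF kernel_Apow]) simp_all
  finally show ?thesis
    by (auto simp: ennreal_mult_top less_top[symmetric] top_unique)
qed

lemma Apow_one_tendsto_0:
  assumes "y \<in> G" shows "(\<lambda>k. (A ^^ k) (\<lambda>_. 1) y) \<longlonglongrightarrow> 0"
proof -
  have fin: "(A ^^ k) (\<lambda>_. 1) y < \<top>" for k
    using sum_Apow_one_finite[OF assms] sum_le_suminf[of "\<lambda>k. (A ^^ k) (\<lambda>_. 1) y" "{k}"]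
    by (auto intro: le_less_trans)
  define a where "a k = enn2real ((A ^^ k) (\<lambda>_. 1) y)" for k
  have a: "(A ^^ k) (\<lambda>_. 1) y = ennreal (a k)" "0 \<le> a k" for k
    using fin[of k] by (simp_all add: a_def)
  have "summable a"
    using sum_Apow_one_finite[OF assms] a(2) unfolding a(1) by (intro summable_suminf_not_top) auto
  then have "a \<longlonglongrightarrow> 0" by (rule summable_LIMSEQ_zero)
  then show ?thesis unfolding a(1) using tendsto_ennrealI by fastforce
qed

text \<open>Comparison principle. The leftover \<open>(A ^^ K) \<phi>\<close> is at most the
  probability of \<open>K\<close> jumps before killing, which vanishes in the limit by
  non-explosion.\<close>

lemma R_ge:
  assumes [measurable]: "\<phi> \<in> borel_measurable borel" "f \<in> borel_measurable borel" "g \<in> borel_measurable borel"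
    and bd: "\<And>x. x \<in> G \<Longrightarrow> \<phi> x \<le> 1"
    and le: "\<And>x. x \<in> G \<Longrightarrow> \<phi> x + r x * f x \<le> A \<phi> x + r x * g x" and y: "y \<in> G"
  shows "\<phi> y + R f y \<le> R g y"
proof (rule LIMSEQ_le)
  let ?S = "\<lambda>h K. \<Sum>k<K. (A ^^ k) (\<lambda>x. r x * h x) y"
  have lim: "?S h \<longlonglongrightarrow> R h y" for h
    unfolding R_def by (rule summable_LIMSEQ) simp
  show "(\<lambda>K. \<phi> y + ?S f K) \<longlonglongrightarrow> \<phi> y + R f y"
    by (intro tendsto_intros lim)
  show "(\<lambda>K. (A ^^ K) (\<lambda>_. 1) y + ?S g K) \<longlonglongrightarrow> R g y"
    using tendsto_add[OF Apow_one_tendsto_0[OF y] lim[of g]] by simp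
  have "\<phi> y + ?S f K \<le> (A ^^ K) (\<lambda>_. 1) y + ?S g K" for K
  proof -
    have "\<phi> y + ?S f K \<le> (A ^^ K) \<phi> y + ?S g K"
      by (rule Apow_ge[OF _ _ _ le y]) measurable
    also have "\<dots> \<le> (A ^^ K) (\<lambda>_. 1) y + ?S g K"
      by (intro add_right_mono Apow_mono_G bd y)
    finally show ?thesis .
  qed
  then show "\<exists>N. \<forall>n\<ge>N. \<phi> y + ?S f n \<le> (A ^^ n) (\<lambda>_. 1) y + ?S g n" by blast
qed

lemma A_one:
  assumes "x \<in> G" shows "A (\<lambda>_. 1) x + r x = 1"
proof -
  have q: "1 \<le> q x" by (rule q_G[OF assms])
  have "A (\<lambda>_. 1) x + r x * ennreal 1 = ennreal (q x / (q x + 1)) + ennreal (1 / (q x + 1))"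
    unfolding A_def J_one[OF assms] r_mult[OF assms] ..
  also have "\<dots> = ennreal ((q x + 1) / (q x + 1))"
    unfolding add_divide_distrib using q by (intro ennreal_plus[symmetric]) auto
  also have "\<dots> = 1" using q by simp
  finally show ?thesis by simp
qed

text \<open>Non-explosion enters in the lower bound, through \<open>R_ge\<close> with the constant 1
  as subsolution.\<close>

lemma R_one:
  assumes y: "y \<in> G" shows "R (\<lambda>_. 1) y = 1"
proof (rule antisym)
  have "(\<Sum>k<K. (A ^^ k) (\<lambda>x. r x * 1) y) \<le> 1" for K
    using Apow_le[of "\<lambda>_. 1" r y K] A_one y
    by (auto intro: order_trans[rotated] simp: add_increasing)
  then show "R (\<lambda>_. 1) y \<le> 1"
    unfolding R_def suminf_eq_SUP by (rule SUP_least)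
  have "1 + R (\<lambda>_. 0) y \<le> R (\<lambda>_. 1) y"
    by (rule R_ge) (use A_one y in auto)
  then show "1 \<le> R (\<lambda>_. 1) y" by (simp add: R.zero)
qed

section \<open>Return from infinity\<close>

lemma nn_integral_unit_linear:
  assumes "0 \<le> a" "0 \<le> b"
  shows "(\<integral>\<^sup>+ u. indicator {0..1} u * ennreal (a + b * u) \<partial>lborel) = ennreal (a + b / 2)"
proof -
  have "(\<integral>\<^sup>+ u. ennreal (a + b * u) * indicator {0..1} u \<partial>lborel) = ennreal ((a * 1 + b * 1 ^ 2 / 2) - (a * 0 + b * 0 ^ 2 / 2))"
    using assms by (intro nn_integral_FTC_Icc) (auto intro!: derivative_eq_intros)
  then show ?thesis by (simp add: mult.commute)
qed

text \<open>\<open>w\<close> is convex in \<open>V\<close> and lies above its tangent; averaging the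
  linear gain over \<open>u\<close> gives the factor 1/2. The leader's contribution is bounded below
  by 0.\<close>

lemma J_w_ge:
  assumes y: "y \<in> G"
  shows "ennreal (\<Sum>i<m. y i * (w y + y i * (w y)\<^sup>2 / 2)) \<le> J (\<lambda>x. ennreal (w x)) y"
proof -
  have Vy: "0 \<le> V y" using V_G[OF y] .
  then have wy: "0 < w y" by (simp add: w_def)
  have "ennreal (w y + y i * (w y)\<^sup>2 / 2) \<le> (\<integral>\<^sup>+ u. indicator {0..1} u * ennreal (w (gap_jump m i u y)) \<partial>lborel)"
    if i: "i < m" for i
  proof -
    have yi: "0 \<le> y i" by (rule G_D[OF y])
    have "ennreal (w y + y i * (w y)\<^sup>2 / 2) = (\<integral>\<^sup>+ u. indicator {0..1} u * ennreal (w y + y i * (w y)\<^sup>2 * u) \<partial>lborel)"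
      using wy yi by (intro nn_integral_unit_linear[symmetric]) auto
    also have "\<dots> \<le> (\<integral>\<^sup>+ u. indicator {0..1} u * ennreal (w (gap_jump m i u y)) \<partial>lborel)"
    proof (rule nn_integral_mono)
      fix u :: real
      show "indicator {0..1} u * ennreal (w y + y i * (w y)\<^sup>2 * u) \<le> indicator {0..1} u * ennreal (w (gap_jump m i u y))"
      proof (cases "u \<in> {0..1}")
        case True
        have 1: "0 \<le> V (gap_jump m i u y)"
          using True i by (intro V_G gap_jump_G y) auto
        define a x where "a = 1 + V y" and "x = y i * u"
        have ax: "0 < a - x" "0 < a" using 1 Vy by (auto simp: V_gap_jump[OF i] a_def x_def)
        \<comment> \<open>The tangent of \<open>1 / (a - x)\<close> at \<open>x = 0\<close>,
          verified through a difference of squares.\<close>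
        have "(1 / a + x * (1 / a)\<^sup>2) * (a - x) = 1 - (x / a)\<^sup>2"
          using ax by (simp add: field_simps power2_eq_square)
        also have "\<dots> \<le> 1" by simp
        finally have "1 / a + x * (1 / a)\<^sup>2 \<le> 1 / (a - x)"
          using ax by (simp add: pos_le_divide_eq)
        then have "w y + y i * (w y)\<^sup>2 * u \<le> w (gap_jump m i u y)"
          by (simp add: w_def V_gap_jump[OF i] a_def x_def algebra_simps)
        then show ?thesis by (intro mult_left_mono ennreal_leI) auto
      qed simp
    qed
    finally show ?thesis .
  qed
  then have "(\<Sum>i<m. ennreal (y i) * ennreal (w y + y i * (w y)\<^sup>2 / 2)) + 0 \<le> J (\<lambda>x. ennreal (w x)) y"
    unfolding J_eq by (intro add_mono sum_mono mult_left_mono) auto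
  moreover have "(\<Sum>i<m. ennreal (y i) * ennreal (w y + y i * (w y)\<^sup>2 / 2)) = ennreal (\<Sum>i<m. y i * (w y + y i * (w y)\<^sup>2 / 2))"
    using wy G_D(1)[OF y]
    by (subst sum_ennreal[symmetric]) (auto simp del: ennreal_plus simp: ennreal_mult'[symmetric])
  ultimately show ?thesis by simp
qed

text \<open>The gain from follower jumps in the lower drift bound for \<open>w\<close>.\<close>

definition b :: "(nat \<Rightarrow> real) \<Rightarrow> real" where
  "b y = (\<Sum>i<m. (y i)\<^sup>2) * (w y)\<^sup>2 / 2"

lemma measurable_b [measurable]: "b \<in> borel_measurable borel"
proof -
  have [measurable]: "(\<lambda>y :: nat \<Rightarrow> real. y i) \<in> borel_measurable borel" for i
    by (rule measurable_apply_coord)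
  show ?thesis unfolding b_def[abs_def] by measurable
qed

text \<open>Cauchy-Schwarz bounds the square of \<open>V\<close> by \<open>m ^ 3\<close> times the
  sum of squared gaps. As \<open>V w = 1 - w\<close>, the gain \<open>b\<close> is bounded below
  wherever \<open>w\<close> is small.\<close>

lemma b_lower:
  assumes y: "y \<in> G"
  shows "1 / (2 * real m ^ 3) \<le> b y + w y / real m ^ 3"
proof -
  have M: "0 < real m" using m_pos by simp
  have Vy: "0 \<le> V y" by (rule V_G[OF y])
  have "(V y)\<^sup>2 \<le> (real m * (\<Sum>i<m. y i))\<^sup>2"
    using V_le_sum[OF y] Vy by (intro power_mono) auto
  also have "\<dots> = (real m)\<^sup>2 * (\<Sum>i<m. y i)\<^sup>2"
    by (rule power_mult_distrib)
  also have "\<dots> \<le> (real m)\<^sup>2 * (real m * (\<Sum>i<m. (y i)\<^sup>2))"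
    using sum_squared_le_sum_of_squares[of y "{..<m}"]
    by (intro mult_left_mono) (simp_all add: mult.commute)
  also have "\<dots> = real m ^ 3 * (\<Sum>i<m. (y i)\<^sup>2)"
    by (simp add: power3_eq_cube power2_eq_square)
  finally have "(V y)\<^sup>2 \<le> real m ^ 3 * (\<Sum>i<m. (y i)\<^sup>2)" .
  then have "(V y)\<^sup>2 * (w y)\<^sup>2 \<le> real m ^ 3 * (\<Sum>i<m. (y i)\<^sup>2) * (w y)\<^sup>2"
    by (rule mult_right_mono) simp
  then have "(V y * w y)\<^sup>2 \<le> real m ^ 3 * 2 * b y"
    by (simp add: power_mult_distrib b_def algebra_simps)
  moreover have "V y * w y = 1 - w y"
    using Vy by (simp add: w_def field_simps)
  moreover have "1 - 2 * w y \<le> (1 - w y)\<^sup>2"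
    by (simp add: power2_diff)
  ultimately have "1 \<le> real m ^ 3 * 2 * b y + 2 * w y"
    by simp
  then show ?thesis using M by (simp add: field_simps)
qed

lemma R_w_ge:
  assumes y: "y \<in> G"
  shows "ennreal (1 / (6 * real m ^ 3)) \<le> R (\<lambda>x. ennreal (w x)) y"
proof -
  have M: "1 \<le> real m ^ 3" "0 < real m" using m_pos by auto
  let ?W = "R (\<lambda>x. ennreal (w x)) y"
  have wx: "0 < w x" "w x \<le> 1" if "x \<in> G" for x
    using V_G[OF that] by (auto simp: w_def)
  have bx: "0 \<le> b x" for x by (auto simp: b_def intro!: mult_nonneg_nonneg sum_nonneg)
  \<comment> \<open>In generator form \<open>L w \<ge> b - w\<close>, where \<open>- w\<close>
    allows a leader jump, at rate 1, to destroy all of \<open>w\<close>. The unit killing costs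
    another \<open>w\<close>, whence \<open>2 * w\<close>.\<close>
  have "ennreal (w x) + r x * ennreal (b x) \<le> A (\<lambda>x. ennreal (w x)) x + r x * ennreal (2 * w x)" if x: "x \<in> G" for x
  proof -
    have qx: "1 \<le> q x" by (rule q_G[OF x])
    have S: "(\<Sum>i<m. x i * (w x + x i * (w x)\<^sup>2 / 2)) = (q x - 1) * w x + b x"
      by (simp add: total_rate_def b_def sum_distrib_right sum_divide_distrib sum.distrib distrib_left power2_eq_square mult.assoc)
    have "ennreal (w x) + r x * ennreal (b x) = ennreal (w x + b x / (q x + 1))"
      using wx[OF x] bx[of x] qx by (simp add: r_mult[OF x])
    also have "w x + b x / (q x + 1) = ((q x - 1) * w x + b x) / (q x + 1) + 2 * w x / (q x + 1)"
    proof -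
      have "w x + b x / (q x + 1) = (w x * (q x + 1) + b x) / (q x + 1)"
        using qx by (simp add: add_divide_distrib)
      also have "w x * (q x + 1) + b x = ((q x - 1) * w x + b x) + 2 * w x"
        by (simp add: algebra_simps)
      finally show ?thesis by (simp only: add_divide_distrib)
    qed
    also have "ennreal \<dots> = r x * ennreal ((q x - 1) * w x + b x) + r x * ennreal (2 * w x)"
      unfolding r_mult[OF x] using qx wx[OF x] bx[of x] by (intro ennreal_plus) auto
    also have "\<dots> \<le> A (\<lambda>x. ennreal (w x)) x + r x * ennreal (2 * w x)"
      unfolding A_def using J_w_ge[OF x] by (intro add_right_mono mult_left_mono) (auto simp: S)
    finally show ?thesis .
  qed
  then have "ennreal (w y) + R (\<lambda>x. ennreal (b x)) y \<le> R (\<lambda>x. ennreal (2 * w x)) y"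
    by (intro R_ge y) (use wx in auto)
  also have "R (\<lambda>x. ennreal (2 * w x)) y = 2 * ?W"
    by (simp add: ennreal_mult' R.cmult)
  finally have 1: "R (\<lambda>x. ennreal (b x)) y \<le> 2 * ?W"
    by (rule order_trans[rotated]) simp
  \<comment> \<open>As \<open>R 1 = 1\<close>, applying \<open>R\<close> to \<open>b_lower\<close>
    bounds \<open>1 / (2 m ^ 3)\<close> by \<open>R b + R w / m ^ 3\<close>, hence by three times
    \<open>R w\<close>.\<close>
  have "ennreal (1 / (2 * real m ^ 3)) = R (\<lambda>x. ennreal (1 / (2 * real m ^ 3)) * 1) y"
    by (subst R.cmult) (simp_all add: R_one[OF y])
  also have "\<dots> \<le> R (\<lambda>x. ennreal (b x) + ennreal (1 / real m ^ 3) * ennreal (w x)) y"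
  proof (rule R_mono_G[OF y])
    fix x assume x: "x \<in> G"
    have "ennreal (1 / (2 * real m ^ 3)) \<le> ennreal (b x + 1 / real m ^ 3 * w x)"
      using b_lower[OF x] by (intro ennreal_leI) simp
    also have "\<dots> = ennreal (b x) + ennreal (1 / real m ^ 3) * ennreal (w x)"
      using wx[OF x] bx[of x] M by (subst ennreal_plus) (auto simp: ennreal_mult'[symmetric])
    finally show "ennreal (1 / (2 * real m ^ 3)) * 1 \<le> ennreal (b x) + ennreal (1 / real m ^ 3) * ennreal (w x)"
      by simp
  qed
  also have "\<dots> = R (\<lambda>x. ennreal (b x)) y + ennreal (1 / real m ^ 3) * ?W"
    by (simp add: R.add R.cmult)
  also have "\<dots> \<le> 2 * ?W + 1 * ?W"
    using M by (intro add_mono 1 mult_right_mono) (auto simp: divide_le_eq_1)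
  also have "\<dots> = (2 + 1) * ?W" by (rule distrib_right[symmetric])
  also have "\<dots> = ennreal 3 * ?W" by simp
  finally have *: "ennreal (1 / (2 * real m ^ 3)) \<le> ennreal 3 * ?W" .
  have "ennreal (1 / (6 * real m ^ 3)) = ennreal (1/3) * ennreal (1 / (2 * real m ^ 3))"
    by (simp add: ennreal_mult'[symmetric])
  also have "\<dots> \<le> ennreal (1/3) * (ennreal 3 * ?W)"
    by (intro mult_left_mono *) simp
  also have "\<dots> = ennreal (1/3 * 3) * ?W"
    by (simp only: mult.assoc[symmetric] ennreal_mult'[symmetric])
  also have "\<dots> = ?W" by simp
  finally show ?thesis .
qed

section \<open>Minorization\<close>

text \<open>Replaces the gaps \<open>m - k, \<dots>, m - 1\<close> by independent uniform variables on \<open>[0, a]\<close>.\<close>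

fun refill :: "real \<Rightarrow> nat \<Rightarrow> ((nat \<Rightarrow> real) \<Rightarrow> ennreal) \<Rightarrow> (nat \<Rightarrow> real) \<Rightarrow> ennreal" where
  "refill a 0 f y = f y"
| "refill a (Suc k) f y = (\<integral>\<^sup>+ v. indicator {0..1} v * refill a k f (y(m - Suc k := a * v)) \<partial>lborel)"

lemma measurable_fun_upd_real [measurable]:
  fixes g :: "'b \<Rightarrow> nat \<Rightarrow> real"
  assumes [measurable]: "h \<in> borel_measurable M" "g \<in> borel_measurable M"
  shows "(\<lambda>x. (g x)(i := h x :: real)) \<in> borel_measurable M"
proof (rule measurable_coordinatewise_then_product)
  fix j :: nat
  have [measurable]: "(\<lambda>x. g x j) \<in> borel_measurable M"
    by (rule measurable_apply_coord'[OF assms(2)])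
  show "(\<lambda>x. ((g x)(i := h x)) j) \<in> borel_measurable M"
    by (cases "j = i") simp_all
qed

lemma kernel_refill: "kernel_op (refill a k)"
proof (induction k)
  case 0
  show ?case using kernel_op_at_point[of "\<lambda>y. y"] by simp
next
  case (Suc k)
  have "kernel_op (\<lambda>f y. \<integral>\<^sup>+ v. indicator {0..1} v * refill a k f (y(m - Suc k := a * v)) \<partial>lborel)"
  proof (rule kernel_op_mix)
    fix v :: real
    have "kernel_op (\<lambda>f y. refill a k f (y(m - Suc k := a * v)))"
      by (rule kernel_op_comp[OF kernel_op_at_point Suc]) measurable
    then show "kernel_op (\<lambda>f y. indicator {0..1} v * refill a k f (y(m - Suc k := a * v)))"
      by (intro kernel_op_mult) auto
  next
    fix f :: "(nat \<Rightarrow> real) \<Rightarrow> ennreal" assume "f \<in> borel_measurable borel"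
    then have [measurable]: "refill a k f \<in> borel_measurable borel"
      by (rule kernel_op.meas[OF Suc])
    show "(\<lambda>(y, v). indicator {0..1} v * refill a k f (y(m - Suc k := a * v)))
        \<in> borel_measurable (borel \<Otimes>\<^sub>M lborel)"
      by measurable
  qed (rule sigma_finite_lborel)
  then show ?case by simp
qed

lemma measurable_refill [measurable]:
  "f \<in> borel_measurable borel \<Longrightarrow> refill a k f \<in> borel_measurable borel"
  by (rule kernel_op.meas[OF kernel_refill])

lemma refill_one: "refill a k (\<lambda>_. 1) y = 1"
  by (induction k arbitrary: y) auto

text \<open>Resampled gaps are overwritten, so their initial values are forgotten.\<close>

lemma refill_cong:
  assumes "k \<le> m" "\<And>j. j < m - k \<or> m \<le> j \<Longrightarrow> x j = y j"
  shows "refill a k f x = refill a k f y"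
  using assms
proof (induction k arbitrary: x y)
  case 0
  then have "x = y" by (auto simp: fun_eq_iff) (meson not_less)
  then show ?case by simp
next
  case (Suc k)
  have "refill a k f (x(m - Suc k := a * v)) = refill a k f (y(m - Suc k := a * v))" for v
  proof (rule Suc.IH)
    fix j assume "j < m - k \<or> m \<le> j"
    then have "j = m - Suc k \<or> j < m - Suc k \<or> m \<le> j" by linarith
    then show "(x(m - Suc k := a * v)) j = (y(m - Suc k := a * v)) j"
      using Suc.prems(2)[of j] by auto
  qed (use Suc.prems in simp)
  then show ?case by simp
qed

text \<open>A follower passes length to the next gap or, if it is the last one, removes it. The
  total rate thus stays bounded along the refilling.\<close>

lemma sum_gap_jump_le:
  assumes "y \<in> G" "0 \<le> u" "i < m"
  shows "(\<Sum>j<m. gap_jump m i u y j) \<le> (\<Sum>j<m. y j)"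
proof -
  have "(\<Sum>j<m. gap_jump m i u y j) =
      (\<Sum>j<m. y j) + y i * u * ((\<Sum>j<m. if Suc i < m then unit_vec (Suc i) j else 0) - (\<Sum>j<m. unit_vec i j))"
    by (simp add: gap_jump_def sum.distrib sum_distrib_left[symmetric] sum_subtractf)
  also have "\<dots> \<le> (\<Sum>j<m. y j) + y i * u * 0"
    using assms G_D(1)[OF assms(1), of i]
    by (intro add_left_mono mult_left_mono) (cases "Suc i < m"; auto simp: unit_vec_def)+
  finally show ?thesis by simp
qed

lemma R_ge_AR:
  assumes "f \<in> borel_measurable borel" shows "r y * J (R f) y \<le> R f y"
  using R_unfold[OF assms, of y] by (simp add: A_def)

lemma r_ge:
  assumes "y \<in> G" "(\<Sum>j<m. y j) \<le> D" shows "ennreal (1 / (D + 2)) \<le> r y"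
proof -
  have "1 / (D + 2) \<le> 1 / (q y + 1)"
    using q_G[OF assms(1)] assms(2) by (intro divide_left_mono) (auto simp: total_rate_def)
  then show ?thesis unfolding r_def by (rule ennreal_leI)
qed

text \<open>
  The gap \<open>m - k\<close> must contain \<open>k a\<close> units: after its jump at most \<open>a\<close> of them stay behind, and the
  rest is passed on to the remaining gaps.
\<close>

lemma R_ge_refill:
  assumes f [measurable]: "f \<in> borel_measurable borel" and a: "0 < a" and D: "0 \<le> D"
  shows "\<lbrakk>k \<le> m; y \<in> G; (\<Sum>j<m. y j) \<le> D; 0 < k \<Longrightarrow> real k * a \<le> y (m - k)\<rbrakk> \<Longrightarrow>
    ennreal ((1 / (D + 2)) ^ Suc k * a ^ k) * refill a k f y \<le> R f y"
proof (induction k arbitrary: y)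
  case 0
  have "ennreal (1 / (D + 2)) * f y \<le> r y * f y"
    by (intro mult_right_mono r_ge 0) auto
  also have "\<dots> \<le> R f y" by (simp add: R_unfold[OF f])
  finally show ?case by simp
next
  case (Suc k)
  let ?c = "ennreal ((1 / (D + 2)) ^ Suc k * a ^ k)"
  define i where "i = m - Suc k"
  have i: "i < m" "m - k = Suc i" using Suc.prems(1) by (auto simp: i_def)
  have yi: "real k * a + a \<le> y i" using Suc.prems(4) by (simp add: i_def algebra_simps)
  moreover have "0 \<le> real k * a" using a by simp
  ultimately have yi0: "0 < y i" "a \<le> y i" using a by linarith+
  let ?g = "\<lambda>u. indicator {0..1} u * R f (gap_jump m i u y)"
  \<comment> \<open>The jump is parametrized by what stays behind: for
    \<open>u = 1 - a v / y i\<close> the remaining gap is \<open>a v\<close>.\<close>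
  have step: "?c * refill a k f (y(i := a * v)) \<le> R f (gap_jump m i (1 - a / y i * v) y)" if v: "0 \<le> v" "v \<le> 1" for v
  proof -
    let ?u = "1 - a / y i * v" let ?x = "gap_jump m i ?u y"
    have "a / y i * v \<le> 1 * 1"
      using v yi0 a by (intro mult_mono) (auto simp: divide_le_eq)
    then have u: "0 \<le> ?u" "?u \<le> 1" using v yi0 a by auto
    have yu: "y i * ?u = y i - a * v" using yi0 by (simp add: field_simps)
    have "?c * refill a k f ?x \<le> R f ?x"
    proof (rule Suc.IH)
      show "k \<le> m" using Suc.prems by simp
      show "?x \<in> G" by (rule gap_jump_G[OF Suc.prems(2) u i(1)])
      show "(\<Sum>j<m. ?x j) \<le> D"
        using sum_gap_jump_le[OF Suc.prems(2) u(1) i(1)] Suc.prems(3) by simp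
      \<comment> \<open>Only in this case is there a next gap; it receives \<open>y i - a v\<close>,
        which is at least \<open>k a\<close>.\<close>
      assume "0 < k"
      then have "Suc i < m" using i Suc.prems(1) by (simp add: i_def)
      then have "?x (m - k) = y (Suc i) + (y i - a * v)"
        unfolding i(2) gap_jump_def yu by (simp add: unit_vec_def)
      moreover have "a * v \<le> a * 1" using v a by (intro mult_left_mono) auto
      ultimately show "real k * a \<le> ?x (m - k)"
        using yi G_D(1)[OF Suc.prems(2), of "Suc i"] by simp
    qed
    moreover have "refill a k f ?x = refill a k f (y(i := a * v))"
    proof (rule refill_cong)
      show "k \<le> m" using Suc.prems by simp
      fix j assume "j < m - k \<or> m \<le> j"
      then have "j < i \<or> j = i \<or> m \<le> j" using i by auto
      then show "?x j = (y(i := a * v)) j"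
        unfolding gap_jump_def yu using i by (auto simp: unit_vec_def)
    qed
    ultimately show ?thesis by simp
  qed
  have "ennreal a * (?c * refill a (Suc k) f y) =
      ennreal a * (\<integral>\<^sup>+ v. ?c * (indicator {0..1} v * refill a k f (y(i := a * v))) \<partial>lborel)"
    by (simp add: i_def nn_integral_cmult)
  also have "\<dots> \<le> ennreal a * (\<integral>\<^sup>+ v. ?g (1 + (- (a / y i)) * v) \<partial>lborel)"
  proof (intro mult_left_mono nn_integral_mono)
    fix v :: real
    show "?c * (indicator {0..1} v * refill a k f (y(i := a * v))) \<le> ?g (1 + (- (a / y i)) * v)"
    proof (cases "v \<in> {0..1}")
      case True
      then have v: "0 \<le> v" "v \<le> 1" by auto
      have "a / y i * v \<le> 1 * 1"
        using v yi0 a by (intro mult_mono) (auto simp: divide_le_eq)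
      then have "1 + (- (a / y i)) * v \<in> {0..1}" using v yi0 a by auto
      then show ?thesis using step[OF v] True by simp
    qed simp
  qed simp
  \<comment> \<open>The Jacobian \<open>a / y i\<close> cancels against the jump rate
    \<open>y i\<close>; the constant \<open>a\<close> that remains does not depend on the
    state.\<close>
  also have "\<dots> = ennreal (y i) * (\<integral>\<^sup>+ u. ?g u \<partial>lborel)"
  proof -
    have "ennreal a = ennreal (y i) * ennreal \<bar>- (a / y i)\<bar>"
      using yi0 a by (simp add: ennreal_mult'[symmetric])
    then show ?thesis
      using yi0 a by (subst nn_integral_real_affine[of ?g "- (a / y i)" 1]) (auto simp: mult.assoc)
  qed
  also have "\<dots> \<le> (\<Sum>i<m. ennreal (y i) * (\<integral>\<^sup>+ u. indicator {0..1} u * R f (gap_jump m i u y) \<partial>lborel))"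
    using i by (intro member_le_sum) auto
  also have "\<dots> \<le> J (R f) y"
    unfolding J_eq by (rule add_increasing2) auto
  finally have "ennreal a * (?c * refill a (Suc k) f y) \<le> J (R f) y" .
  then have "ennreal (1 / (D + 2)) * (ennreal a * (?c * refill a (Suc k) f y)) \<le> r y * J (R f) y"
    by (intro mult_mono r_ge Suc.prems) auto
  also have "\<dots> \<le> R f y" by (rule R_ge_AR[OF f])
  also have "ennreal (1 / (D + 2)) * (ennreal a * (?c * refill a (Suc k) f y)) =
     ennreal ((1 / (D + 2)) ^ Suc (Suc k) * a ^ Suc k) * refill a (Suc k) f y"
  proof -
    define c where "c = (1 / (D + 2)) ^ Suc k * a ^ k"
    have "(1 / (D + 2)) ^ Suc (Suc k) * a ^ Suc k = 1 / (D + 2) * (a * c)"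
      by (simp add: c_def)
    then have "ennreal ((1 / (D + 2)) ^ Suc (Suc k) * a ^ Suc k) = ennreal (1 / (D + 2) * (a * c))"
      by (rule arg_cong)
    also have "\<dots> = ennreal (1 / (D + 2)) * (ennreal a * ennreal c)"
      using a D by (subst ennreal_mult', simp, subst ennreal_mult') auto
    finally have eq: "ennreal ((1 / (D + 2)) ^ Suc (Suc k) * a ^ Suc k) = ennreal (1 / (D + 2)) * (ennreal a * ennreal c)" .
    show ?thesis unfolding eq unfolding c_def by (simp only: mult.assoc)
  qed
  finally show ?case .
qed

text \<open>Compact intervals exhaust the positive half-line and cannot all be null. The lower
  endpoint supplies length for the refilling, the upper one keeps the rates bounded.\<close>

lemma theta_interval:
  obtains z0 z1 where "0 < z0" "z0 \<le> z1" "0 < measure \<theta> {z0..z1}"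
proof -
  have "\<exists>n::nat. emeasure \<theta> {1 / real (Suc n)..real (Suc n)} \<noteq> 0"
  proof (rule ccontr)
    assume "\<not> ?thesis"
    then have "{1 / real (Suc n)..real (Suc n)} \<in> null_sets \<theta>" for n
      by (auto intro: null_setsI simp: theta_sets)
    then have "AE z in \<theta>. \<forall>n. z \<notin> {1 / real (Suc n)..real (Suc n)}"
      by (intro AE_all_countable[THEN iffD2] allI AE_not_in)
    with theta_pos have "AE z in \<theta>. False"
    proof eventually_elim
      case (elim z)
      obtain n1 where n1: "1 / real (Suc n1) < z"
        using reals_Archimedean[OF elim(1)] by (auto simp: inverse_eq_divide)
      obtain n2 where n2: "z < real n2" using reals_Archimedean2 by blast
      have "1 / real (Suc (max n1 n2)) \<le> 1 / real (Suc n1)" by (intro divide_left_mono) auto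
      then have "z \<in> {1 / real (Suc (max n1 n2))..real (Suc (max n1 n2))}" using n1 n2 by auto
      then show ?case using elim(2) by blast
    qed
    then show False by simp
  qed
  then obtain n where n: "emeasure \<theta> {1 / real (Suc n)..real (Suc n)} \<noteq> 0" by auto
  show ?thesis
  proof (rule that)
    show "1 / real (Suc n) \<le> real (Suc n)" by (simp add: divide_le_eq) (simp add: algebra_simps)
    show "0 < measure \<theta> {1 / real (Suc n)..real (Suc n)}"
      using n by (simp add: theta.emeasure_eq_measure zero_less_measure_iff)
  qed simp
qed

lemma R_minorization:
  assumes C: "0 \<le> C"
  shows "\<exists>a \<kappa>. 0 < \<kappa> \<and> (\<forall>f y. f \<in> borel_measurable borel \<longrightarrow> y \<in> G \<longrightarrow> V y \<le> C \<longrightarrow>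
      ennreal \<kappa> * refill a m f (\<lambda>_. 0) \<le> R f y)"
proof -
  obtain z0 z1 where z: "0 < z0" "z0 \<le> z1" "0 < measure \<theta> {z0..z1}"
    by (rule theta_interval)
  \<comment> \<open>After the leader's jump the first gap is at least \<open>z0 = m a\<close>, as
    \<open>R_ge_refill\<close> requires for \<open>k = m\<close>; \<open>D\<close> bounds the total
    gap at that moment.\<close>
  define a where "a = z0 / real m"
  define D where "D = C + z1"
  define c where "c = (1 / (D + 2)) ^ Suc m * a ^ m"
  define \<kappa> where "\<kappa> = 1 / (C + 2) * (c * measure \<theta> {z0..z1})"
  have a: "0 < a" using z m_pos by (simp add: a_def)
  have D: "0 \<le> D" using z C by (simp add: D_def)
  have c: "0 < c" using a D by (simp add: c_def)
  have \<kappa>: "0 < \<kappa>" using z C c by (simp add: \<kappa>_def)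
  have main: "ennreal \<kappa> * refill a m f (\<lambda>_. 0) \<le> R f y"
    if f [measurable]: "f \<in> borel_measurable borel" and y: "y \<in> G" and Vy: "V y \<le> C" for f y
  proof -
    let ?N = "refill a m f (\<lambda>_. 0)"
    have S: "(\<Sum>j<m. y j) \<le> C" using sum_le_V[OF y] Vy by simp
    have "ennreal c * ?N \<le> R f (lead_jump z y)" if "z \<in> {z0..z1}" for z
    proof -
      let ?x = "lead_jump z y"
      have z: "0 \<le> z" "z0 \<le> z" "z \<le> z1" using that \<open>0 < z0\<close> by auto
      have x: "?x \<in> G" by (rule lead_jump_G[OF y z(1)])
      have "(\<Sum>j<m. ?x j) = (\<Sum>j<m. y j) + z"
        using m_pos by (simp add: lead_jump_def sum.distrib sum_distrib_left[symmetric] unit_vec_def)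
      then have xD: "(\<Sum>j<m. ?x j) \<le> D" using S z by (simp add: D_def)
      have "real m * a = z0" using m_pos by (simp add: a_def)
      also have "z0 \<le> ?x (m - m)"
        using z G_D(1)[OF y, of 0] by (simp add: lead_jump_def unit_vec_def)
      finally have "ennreal c * refill a m f ?x \<le> R f ?x"
        unfolding c_def by (intro R_ge_refill[OF f a D order_refl x xD])
      \<comment> \<open>All \<open>m\<close> gaps are resampled, so the bound no longer depends on
        \<open>y\<close>.\<close>
      moreover have "refill a m f ?x = ?N"
      proof (rule refill_cong[OF order_refl])
        fix j assume "j < m - m \<or> m \<le> j"
        then show "?x j = 0" using G_D(2)[OF x] by simp
      qed
      ultimately show ?thesis by simp
    qed
    then have "ennreal c * ?N * indicator {z0..z1} z \<le> R f (lead_jump z y)" for z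
      by (cases "z \<in> {z0..z1}") simp_all
    then have "(\<integral>\<^sup>+ z. ennreal c * ?N * indicator {z0..z1} z \<partial>\<theta>) \<le> (\<integral>\<^sup>+ z. R f (lead_jump z y) \<partial>\<theta>)"
      by (rule nn_integral_mono)
    also have "\<dots> \<le> J (R f) y"
      unfolding J_eq by (rule add_increasing) auto
    also have "(\<integral>\<^sup>+ z. ennreal c * ?N * indicator {z0..z1} z \<partial>\<theta>) = ennreal c * ?N * ennreal (measure \<theta> {z0..z1})"
      by (subst nn_integral_cmult) (auto simp: theta.emeasure_eq_measure)
    finally have "ennreal (1 / (C + 2)) * (ennreal c * ?N * ennreal (measure \<theta> {z0..z1})) \<le> r y * J (R f) y"
      by (intro mult_mono r_ge y S) auto
    also have "\<dots> \<le> R f y" by (rule R_ge_AR[OF f])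
    also have "ennreal (1 / (C + 2)) * (ennreal c * ?N * ennreal (measure \<theta> {z0..z1})) = ennreal \<kappa> * ?N"
    proof -
      have "ennreal \<kappa> = ennreal (1 / (C + 2)) * (ennreal c * ennreal (measure \<theta> {z0..z1}))"
        unfolding \<kappa>_def using c C by (subst ennreal_mult', simp, subst ennreal_mult') auto
      moreover have "x * (y * N * z) = x * (y * z) * N" for x y z N :: ennreal
        by (simp only: mult_ac)
      ultimately show ?thesis by (simp only:)
    qed
    finally show ?thesis .
  qed
  show ?thesis
    by (rule exI[of _ a], rule exI[of _ \<kappa>], intro conjI allI impI \<kappa> main)
qed

text \<open>Above level \<open>C\<close> the function \<open>w\<close> is at most
  \<open>1 / (1 + C)\<close>, elsewhere on \<open>G\<close> at most 1.\<close>

lemma R_w_le_level: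
  assumes y: "y \<in> G" and C: "0 \<le> C"
  shows "R (\<lambda>x. ennreal (w x)) y \<le> R (indicator {x. V x \<le> C}) y + ennreal (1 / (1 + C))"
proof -
  have "R (\<lambda>x. ennreal (w x)) y \<le> R (\<lambda>x. indicator {x. V x \<le> C} x + ennreal (1 / (1 + C)) * 1) y"
  proof (rule R_mono_G[OF y])
    fix x assume x: "x \<in> G"
    have "w x \<le> 1" using V_G[OF x] by (simp add: w_def)
    moreover have "w x \<le> 1 / (1 + C)" if "C < V x"
      using that C by (auto simp: w_def intro!: divide_left_mono mult_pos_pos)
    ultimately show "ennreal (w x) \<le> indicator {x. V x \<le> C} x + ennreal (1 / (1 + C)) * 1"
      by (auto split: split_indicator intro!: ennreal_leI add_increasing2 simp: ennreal_le_1)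
  qed
  also have "\<dots> = R (indicator {x. V x \<le> C}) y + ennreal (1 / (1 + C))"
  proof -
    have "R (\<lambda>x. ennreal (1 / (1 + C)) * 1) y = ennreal (1 / (1 + C)) * R (\<lambda>_. 1) y"
      by (rule R.cmult) simp
    then show ?thesis
      by (subst R.add) (simp_all add: R_one[OF y])
  qed
  finally show ?thesis .
qed

text \<open>The outer \<open>R\<close> reaches a level set of \<open>V\<close> with probability
  bounded below; from there the inner \<open>R\<close> spreads the process over the cube.\<close>

lemma doeblin_RR:
  obtains a \<epsilon> where "doeblin (\<lambda>f. R (R f)) G (push (return borel (\<lambda>_. 0)) (refill a m)) \<epsilon>"
proof -
  define \<eta> where "\<eta> = 1 / (6 * real m ^ 3)"
  have "1 \<le> 6 * real m ^ 3" using m_pos one_le_power[of "real m" 3] by linarith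
  then have \<eta>: "0 < \<eta>" "\<eta> \<le> 1" using m_pos by (auto simp: \<eta>_def divide_le_eq)
  \<comment> \<open>This makes \<open>1 / (1 + C)\<close> half of the lower bound
    \<open>\<eta>\<close> for \<open>R w\<close>, so the other half must come from the level
    set.\<close>
  define C where "C = 2 / \<eta> - 1"
  have C: "0 \<le> C" "1 / (1 + C) = \<eta> / 2" using \<eta> by (auto simp: C_def field_simps)
  obtain a \<kappa> where \<kappa>: "0 < \<kappa>" and
    minor: "\<And>f y. f \<in> borel_measurable borel \<Longrightarrow> y \<in> G \<Longrightarrow> V y \<le> C \<Longrightarrow>
      ennreal \<kappa> * refill a m f (\<lambda>_. 0) \<le> R f y"
    using R_minorization[OF C(1)] by blast
  let ?\<nu> = "push (return borel (\<lambda>_. 0)) (refill a m)"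
  let ?I = "indicator {x. V x \<le> C} :: (nat \<Rightarrow> real) \<Rightarrow> ennreal"
  have level: "ennreal (\<eta> / 2) \<le> R ?I y" if y: "y \<in> G" for y
  proof -
    have "ennreal (\<eta> / 2) + ennreal (\<eta> / 2) = ennreal \<eta>"
      using \<eta> by (subst ennreal_plus[symmetric]) auto
    also have "\<dots> \<le> R ?I y + ennreal (\<eta> / 2)"
      using order_trans[OF R_w_ge[OF y] R_w_le_level[OF y C(1)]] by (simp only: C(2) \<eta>_def)
    finally show ?thesis by (simp add: ennreal_add_left_cancel_le add.commute)
  qed
  have "doeblin (\<lambda>f. R (R f)) G ?\<nu> (\<kappa> * (\<eta> / 2))"
  proof (intro doeblin.intro doeblin_axioms.intro)
    show "kernel_op (\<lambda>f. R (R f))" by (rule kernel_op_comp[OF kernel_R kernel_R])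
    show "G \<in> sets borel" by measurable
    have "(\<lambda>_. 0) \<in> G" by (simp add: gap_space_def)
    then show "G \<noteq> {}" by auto
    show "R (R (\<lambda>_. 1)) y = 1" if "y \<in> G" for y
      using R_cong_G[OF that, of "R (\<lambda>_. 1)" "\<lambda>_. 1"] by (simp add: R_one that)
    have 0: "R (indicator (- G)) y = 0" if "y \<in> G" for y
      using R_cong_G[OF that, of "indicator (- G)" "\<lambda>_. 0"] by (simp add: R.zero)
    show "R (R (indicator (- G))) y = 0" if "y \<in> G" for y
      using R_cong_G[OF that, of "R (indicator (- G))" "\<lambda>_. 0"] 0 by (simp add: R.zero)
    show "prob_space ?\<nu>"
      using kernel_op_at[OF kernel_refill, of "\<lambda>_. 1" a m "\<lambda>_. 0"]
      by (intro prob_spaceI) (simp add: refill_one)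
    show "0 < \<kappa> * (\<eta> / 2)" using \<kappa> \<eta> by simp
    fix f :: "(nat \<Rightarrow> real) \<Rightarrow> ennreal" and y assume f [measurable]: "f \<in> borel_measurable borel" and y: "y \<in> G"
    let ?N = "refill a m f (\<lambda>_. 0)"
    have "ennreal (\<kappa> * (\<eta> / 2)) * (\<integral>\<^sup>+ x. f x \<partial>?\<nu>) = ennreal \<kappa> * ?N * ennreal (\<eta> / 2)"
    proof -
      have "ennreal (\<kappa> * (\<eta> / 2)) = ennreal \<kappa> * ennreal (\<eta> / 2)"
        using \<kappa> by (intro ennreal_mult') auto
      moreover have "(\<integral>\<^sup>+ x. f x \<partial>?\<nu>) = ?N"
        by (rule kernel_op_at[OF kernel_refill f, symmetric])
      moreover have "x * z * N = x * N * z" for x z N :: ennreal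
        by (simp only: mult_ac)
      ultimately show ?thesis by (simp only:)
    qed
    also have "\<dots> \<le> ennreal \<kappa> * ?N * R ?I y"
      by (intro mult_left_mono level y) simp
    also have "\<dots> = R (\<lambda>x. ennreal \<kappa> * ?N * ?I x) y"
      by (subst R.cmult) simp_all
    also have "\<dots> \<le> R (R f) y"
    proof (rule R_mono_G[OF y])
      fix x assume "x \<in> G"
      then show "ennreal \<kappa> * ?N * ?I x \<le> R f x"
        using minor[OF f, of x] by (cases "V x \<le> C") simp_all
    qed
    finally show "ennreal (\<kappa> * (\<eta> / 2)) * (\<integral>\<^sup>+ x. f x \<partial>?\<nu>) \<le> R (R f) y" .
  qed simp
  then show ?thesis by (rule that)
qed

section \<open>From the resolvent to the semigroup\<close>

text \<open>Conditioning on the first jump and bounding what follows by 1 leaves the probability of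
  a jump before \<open>t\<close>, which complements that of no jump.\<close>

lemma Pk_sum_le_one:
  "y \<in> G \<Longrightarrow> 0 \<le> t \<Longrightarrow> (\<Sum>k<K. Pk k t (\<lambda>_. 1) y) \<le> 1"
proof (induction K arbitrary: t y)
  case (Suc K)
  let ?e = "\<lambda>s. ennreal (exp (- q y * s))"
  have qy: "1 \<le> q y" by (rule q_G[OF Suc.prems(1)])
  have m: "(\<lambda>s. indicator {0..t} s * ?e s * J (\<lambda>z. Pk k (t - s) (\<lambda>_. 1) z) y) \<in> borel_measurable lborel" for k
  proof -
    have "(\<lambda>s. J (\<lambda>z. Pk k (t - s) (\<lambda>_. 1) z) y) \<in> borel_measurable lborel"
      by (rule measurable_J_Pk) auto
    then show ?thesis
      by (intro borel_measurable_times_ennreal) auto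
  qed
  have "(\<Sum>k<K. Pk (Suc k) t (\<lambda>_. 1) y) =
      (\<integral>\<^sup>+ s. (\<Sum>k<K. indicator {0..t} s * ?e s * J (\<lambda>z. Pk k (t - s) (\<lambda>_. 1) z) y) \<partial>lborel)"
    unfolding trans_k.simps by (rule nn_integral_sum[symmetric]) (rule m)
  also have "\<dots> = (\<integral>\<^sup>+ s. indicator {0..t} s * ?e s * J (\<lambda>z. \<Sum>k<K. Pk k (t - s) (\<lambda>_. 1) z) y \<partial>lborel)"
    by (simp add: J.sum sum_distrib_left)
  also have "\<dots> \<le> (\<integral>\<^sup>+ s. ennreal (q y * exp (- q y * s)) * indicator {0..t} s \<partial>lborel)"
  proof (rule nn_integral_mono)
    fix s :: real
    have "?e s * J (\<lambda>z. \<Sum>k<K. Pk k (t - s) (\<lambda>_. 1) z) y \<le> ennreal (q y * exp (- q y * s))" if "s \<le> t"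
    proof -
      have "J (\<lambda>z. \<Sum>k<K. Pk k (t - s) (\<lambda>_. 1) z) y \<le> J (\<lambda>_. 1) y"
        by (rule J_mono_G[OF Suc.prems(1)]) (use Suc.IH that in auto)
      then have "?e s * J (\<lambda>z. \<Sum>k<K. Pk k (t - s) (\<lambda>_. 1) z) y \<le> ?e s * ennreal (q y)"
        unfolding J_one[OF Suc.prems(1)] by (rule mult_left_mono) simp
      then show ?thesis using qy by (simp add: ennreal_mult' mult.commute)
    qed
    then show "indicator {0..t} s * ?e s * J (\<lambda>z. \<Sum>k<K. Pk k (t - s) (\<lambda>_. 1) z) y
        \<le> ennreal (q y * exp (- q y * s)) * indicator {0..t} s"
      by (cases "s \<in> {0..t}") simp_all
  qed
  also have "\<dots> = ennreal (- exp (- q y * t) - (- exp (- q y * 0)))"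
    using qy Suc.prems(2) by (intro nn_integral_FTC_Icc) (auto intro!: derivative_eq_intros)
  finally have "(\<Sum>k<Suc K. Pk k t (\<lambda>_. 1) y) \<le> ennreal (exp (- q y * t)) + ennreal (1 - exp (- q y * t))"
    unfolding sum.lessThan_Suc_shift by (intro add_mono) auto
  also have "\<dots> = ennreal (exp (- q y * t) + (1 - exp (- q y * t)))"
    using qy Suc.prems(2) by (intro ennreal_plus[symmetric]) auto
  finally show ?case by simp
qed simp

lemma P_one_le: "y \<in> G \<Longrightarrow> 0 \<le> t \<Longrightarrow> P t (\<lambda>_. 1) y \<le> 1"
  unfolding trans_def suminf_eq_SUP by (intro SUP_least Pk_sum_le_one)

lemma Pk_outside:
  "y \<in> G \<Longrightarrow> Pk k t (indicator (- G)) y = 0"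
proof (induction k arbitrary: y t)
  case (Suc k)
  have "J (\<lambda>z. Pk k (t - s) (indicator (- G)) z) y = J (\<lambda>_. 0) y" for s
    by (rule J_cong_G[OF Suc.prems Suc.IH])
  then show ?case by (simp add: J.zero)
qed simp

lemma P_outside: "y \<in> G \<Longrightarrow> P t (indicator (- G)) y = 0"
  by (simp add: trans_def Pk_outside)

lemma P_mono_G:
  assumes y: "y \<in> G" and [measurable]: "f \<in> borel_measurable borel" "g \<in> borel_measurable borel"
    and le: "\<And>x. x \<in> G \<Longrightarrow> f x \<le> g x"
  shows "P t f y \<le> P t g y"
proof -
  interpret P: kernel_op "P t" by (rule kernel_P)
  \<comment> \<open>The infinite penalty off \<open>G\<close> makes the comparison hold everywhere;
    it costs nothing since \<open>P t\<close> from \<open>y\<close> does not charge the complement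
    of \<open>G\<close>.\<close>
  have "P t f y \<le> P t (\<lambda>x. g x + \<top> * indicator (- G) x) y"
  proof (rule P.mono)
    fix x
    show "f x \<le> g x + \<top> * indicator (- G) x"
      using le[of x] by (cases "x \<in> G") (simp_all add: ennreal_top_mult)
  qed measurable
  also have "\<dots> = P t g y"
    by (simp add: P.add P.cmult P_outside[OF y])
  finally show ?thesis .
qed

lemma P_cong_G:
  assumes "y \<in> G" "f \<in> borel_measurable borel" "g \<in> borel_measurable borel"
    and "\<And>x. x \<in> G \<Longrightarrow> f x = g x"
  shows "P t f y = P t g y"
  using assms by (intro antisym P_mono_G) auto

text \<open>\<open>P\<^sub>t 1 \<le> 1\<close> is nonincreasing in \<open>t\<close>, so a defect at time \<open>t\<close> would make \<open>R 1 < 1\<close>.\<close>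

lemma P_one:
  assumes y: "y \<in> G" and t: "0 \<le> t"
  shows "P t (\<lambda>_. 1) y = 1"
proof (rule antisym)
  let ?p = "\<lambda>t. P t (\<lambda>_. 1) y"
  obtain c where c: "?p t = ennreal c" "0 \<le> c"
    using P_one_le[OF y t] by (cases "?p t" rule: ennreal_cases) (auto simp: top_unique)
  have dec: "?p s \<le> ?p t" if "t \<le> s" for s
  proof -
    have "?p s = P t (P (s - t) (\<lambda>_. 1)) y"
      using P_add[of "\<lambda>_. 1" "s - t" t y] that t by simp
    also have "\<dots> \<le> ?p t"
      by (rule P_mono_G[OF y]) (use that in \<open>auto intro!: P_one_le\<close>)
    finally show ?thesis .
  qed
  \<comment> \<open>With the bound 1 before \<open>t\<close> and \<open>c\<close> afterwards, this
    gives \<open>1 \<le> 1 - exp (- t) + c * exp (- t)\<close> and hence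
    \<open>c \<ge> 1\<close>.\<close>
  have "1 = (\<integral>\<^sup>+ s. indicator {0..} s * ennreal (exp (- s)) * ?p s \<partial>lborel)"
    by (simp add: laplace_P y R_one)
  also have "\<dots> \<le> (\<integral>\<^sup>+ s. ennreal (exp (- s)) * indicator {0..t} s + ennreal (c * exp (- s)) * indicator {t..} s \<partial>lborel)"
  proof (rule nn_integral_mono)
    fix s :: real
    have 1: "ennreal (exp (- s)) * ?p s \<le> ennreal (exp (- s))" if "0 \<le> s"
      using mult_left_mono[OF P_one_le[OF y that], of "ennreal (exp (- s))"] by simp
    have 2: "ennreal (exp (- s)) * ?p s \<le> ennreal (c * exp (- s))" if "t \<le> s"
      using mult_left_mono[OF dec[OF that], of "ennreal (exp (- s))"] c
      by (simp add: ennreal_mult' mult.commute)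
    consider "s < 0" | "0 \<le> s" "s \<le> t" | "t < s" by linarith
    then show "indicator {0..} s * ennreal (exp (- s)) * ?p s \<le>
        ennreal (exp (- s)) * indicator {0..t} s + ennreal (c * exp (- s)) * indicator {t..} s"
      using 1 2 t by cases (auto intro: add_increasing2)
  qed
  also have "\<dots> = (\<integral>\<^sup>+ s. ennreal (exp (- s)) * indicator {0..t} s \<partial>lborel) + (\<integral>\<^sup>+ s. ennreal (c * exp (- s)) * indicator {t..} s \<partial>lborel)"
    by (rule nn_integral_add) measurable
  also have "(\<integral>\<^sup>+ s. ennreal (exp (- s)) * indicator {0..t} s \<partial>lborel) = ennreal (- exp (- t) - (- exp (- 0)))"
    using t by (intro nn_integral_FTC_Icc) (auto intro!: derivative_eq_intros)
  also have "(\<integral>\<^sup>+ s. ennreal (c * exp (- s)) * indicator {t..} s \<partial>lborel) = ennreal (0 - (- c * exp (- t)))"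
  proof (rule nn_integral_FTC_atLeast)
    show "((\<lambda>s. - c * exp (- s)) \<longlongrightarrow> 0) at_top" by real_asymp
  qed (use c in \<open>auto intro!: derivative_eq_intros\<close>)
  also have "ennreal (- exp (- t) - (- exp (- 0))) + ennreal (0 - (- c * exp (- t))) = ennreal (1 - exp (- t) + c * exp (- t))"
    using t c by (subst ennreal_plus[symmetric]) auto
  finally have "ennreal 1 \<le> ennreal (1 - exp (- t) + c * exp (- t))" by simp
  moreover have "0 \<le> 1 - exp (- t) + c * exp (- t)" using t c by simp
  ultimately have "1 \<le> 1 - exp (- t) + c * exp (- t)"
    by (simp only: ennreal_le_iff)
  then have "0 \<le> (c - 1) * exp (- t)" by (simp add: algebra_simps)
  then have "1 \<le> c" by (simp add: zero_le_mult_iff)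
  then show "1 \<le> ?p t" by (simp add: c)
qed (rule P_one_le[OF y t])

text \<open>\<open>R\<close> is an exponential mixture of the \<open>P s\<close>, which commute with
  \<open>P t\<close> by the semigroup law; finiteness of \<open>P t 1\<close> permits
  Fubini.\<close>

lemma P_R_commute:
  assumes f [measurable]: "f \<in> borel_measurable borel" and y: "y \<in> G" and t: "0 \<le> t"
  shows "P t (R f) y = R (P t f) y"
proof -
  interpret P: kernel_op "P t" by (rule kernel_P)
  note P.meas[measurable]
  let ?e = "\<lambda>s. indicator {0..} s * ennreal (exp (- s))"
  have "R (P t f) y = (\<integral>\<^sup>+ s. ?e s * P s (P t f) y \<partial>lborel)"
    by (rule laplace_P[symmetric]) (use y in auto)
  also have "\<dots> = (\<integral>\<^sup>+ s. P t (\<lambda>z. ?e s * P s f z) y \<partial>lborel)"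
  proof (rule nn_integral_cong)
    fix s :: real
    have "P s (P t f) y = P t (P s f) y" if "0 \<le> s"
      using P_add[OF f t that, of y] P_add[OF f that t, of y] by (simp add: add.commute)
    then show "?e s * P s (P t f) y = P t (\<lambda>z. ?e s * P s f z) y"
      by (subst P.cmult) (auto split: split_indicator)
  qed
  also have "\<dots> = P t (\<lambda>z. \<integral>\<^sup>+ s. ?e s * P s f z \<partial>lborel) y"
  proof (rule kernel_op_nn_integral[OF kernel_P _ sigma_finite_lborel, symmetric])
    show "P t (\<lambda>_. 1) y < \<top>"
      using P_one_le[OF y t] by (rule le_less_trans) simp
  qed measurable
  also have "\<dots> = P t (R f) y"
    by (rule P_cong_G[OF y]) (auto simp: laplace_P)
  finally show ?thesis by simp
qed

section \<open>Stationary laws\<close>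

lemma stationary_push:
  assumes "stationary_gap m \<theta> \<pi>" "0 \<le> t"
  shows "push \<pi> (P t) = \<pi>"
proof (rule measure_eqI)
  fix A assume "A \<in> sets (push \<pi> (P t))"
  then show "emeasure (push \<pi> (P t)) A = emeasure \<pi> A"
    using assms by (simp add: emeasure_push[OF kernel_P] stationary_gap_def)
qed (use assms in \<open>simp add: stationary_gap_def\<close>)

text \<open>Invariance under every \<open>P s\<close> survives averaging over a unit exponential
  time.\<close>

lemma stationary_R:
  assumes \<pi>: "stationary_gap m \<theta> \<pi>" and [measurable]: "f \<in> borel_measurable borel"
  shows "(\<integral>\<^sup>+ y. R f y \<partial>\<pi>) = (\<integral>\<^sup>+ y. f y \<partial>\<pi>)"
proof -
  interpret \<pi>: prob_space \<pi> using \<pi> by (simp add: stationary_gap_def)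
  have sets: "sets \<pi> = sets borel" using \<pi> by (simp add: stationary_gap_def)
  note [measurable_cong] = sets
  have G: "AE y in \<pi>. y \<in> G"
    using \<pi> \<pi>.prob_eq_1[of G] sets by (simp add: stationary_gap_def \<pi>.emeasure_eq_measure)
  interpret pair: pair_sigma_finite lborel \<pi> ..
  let ?e = "\<lambda>s. indicator {0..} s * ennreal (exp (- s))"
  have "(\<integral>\<^sup>+ y. R f y \<partial>\<pi>) = (\<integral>\<^sup>+ y. (\<integral>\<^sup>+ s. ?e s * P s f y \<partial>lborel) \<partial>\<pi>)"
    using G by (intro nn_integral_cong_AE) (auto simp: laplace_P)
  also have "\<dots> = (\<integral>\<^sup>+ s. (\<integral>\<^sup>+ y. ?e s * P s f y \<partial>\<pi>) \<partial>lborel)"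
    by (rule pair.Fubini') measurable
  also have "\<dots> = (\<integral>\<^sup>+ s. ?e s * (\<integral>\<^sup>+ y. f y \<partial>\<pi>) \<partial>lborel)"
  proof (rule nn_integral_cong)
    fix s :: real
    have "(\<integral>\<^sup>+ y. P s f y \<partial>\<pi>) = (\<integral>\<^sup>+ y. f y \<partial>\<pi>)" if "0 \<le> s"
      using nn_integral_push[OF kernel_P sets, of f s] stationary_push[OF \<pi> that] by simp
    then show "(\<integral>\<^sup>+ y. ?e s * P s f y \<partial>\<pi>) = ?e s * (\<integral>\<^sup>+ y. f y \<partial>\<pi>)"
      by (subst nn_integral_cmult) (auto split: split_indicator)
  qed
  also have "\<dots> = (\<integral>\<^sup>+ y. f y \<partial>\<pi>)"
    using nn_integral_exp_Ici[of 1] by (simp add: nn_integral_multc)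
  finally show ?thesis .
qed

lemma ex1_stationary_gap: "\<exists>!\<pi>. stationary_gap m \<theta> \<pi>"
proof -
  obtain a \<epsilon> where "doeblin (\<lambda>f. R (R f)) G (push (return borel (\<lambda>_. 0)) (refill a m)) \<epsilon>"
    by (rule doeblin_RR)
  then interpret D: doeblin "\<lambda>f. R (R f)" G "push (return borel (\<lambda>_. 0)) (refill a m)" \<epsilon> .
  let ?RR = "\<lambda>f. R (R f)"
  \<comment> \<open>Applying \<open>stationary_R\<close> twice makes a stationary law invariant
    under \<open>?RR\<close>, where uniqueness is known.\<close>
  have unique: "\<pi> = D.inv_dist" if \<pi>: "stationary_gap m \<theta> \<pi>" for \<pi>
  proof (rule D.unique)
    interpret \<pi>: prob_space \<pi> using \<pi> by (simp add: stationary_gap_def)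
    have s: "sets \<pi> = sets borel" "space \<pi> = UNIV"
      using \<pi> sets_eq_imp_space_eq[of \<pi> borel] by (auto simp: stationary_gap_def)
    show 1: "emeasure \<pi> UNIV = 1" using \<pi>.emeasure_space_1 s by simp
    have "emeasure \<pi> (space \<pi> - G) = emeasure \<pi> (space \<pi>) - emeasure \<pi> G"
      using s by (intro emeasure_compl) auto
    then have "emeasure \<pi> (- G) = 0"
      using \<pi> s 1 by (simp add: stationary_gap_def Compl_eq_Diff_UNIV)
    then show "D.carried \<pi>" using s 1 by (simp add: D.carried_def)
    show "push \<pi> ?RR = \<pi>"
      using s by (intro measure_eqI) (simp_all add: emeasure_push[OF D.kernel_op_axioms] stationary_R[OF \<pi>])
  qed
  have sets: "sets D.inv_dist = sets borel" by (rule D.sets_inv_dist)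
  note [measurable_cong] = sets
  have G: "AE y in D.inv_dist. y \<in> G" by (rule D.carriedD(4)[OF D.carried_inv_dist])
  have space: "space D.inv_dist = UNIV" by (rule D.carriedD(2)[OF D.carried_inv_dist])
  interpret inv: prob_space D.inv_dist
    using D.inv_dist_UNIV space by (intro prob_spaceI) simp
  \<comment> \<open>By commutation the pushed law is again invariant under \<open>?RR\<close>, and
    it is a probability law carried by \<open>G\<close>; uniqueness identifies it with
    \<open>D.inv_dist\<close>.\<close>
  have push: "push D.inv_dist (P t) = D.inv_dist" if t: "0 \<le> t" for t
  proof (rule D.unique)
    let ?p = "push D.inv_dist (P t)"
    have e: "emeasure ?p A = (\<integral>\<^sup>+ y. P t (indicator A) y \<partial>D.inv_dist)" if "A \<in> sets borel" for A
      by (rule emeasure_push[OF kernel_P sets that])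
    have "emeasure ?p UNIV = (\<integral>\<^sup>+ y. P t (\<lambda>_. 1) y \<partial>D.inv_dist)"
      using e[of UNIV] by (simp add: indicator_def[abs_def])
    also have "\<dots> = (\<integral>\<^sup>+ y. 1 \<partial>D.inv_dist)"
      using G by (intro nn_integral_cong_AE) (auto simp: P_one t)
    finally show 1: "emeasure ?p UNIV = 1" using inv.emeasure_space_1 by simp
    have "emeasure ?p (- G) = (\<integral>\<^sup>+ y. P t (indicator (- G)) y \<partial>D.inv_dist)"
      by (rule e) measurable
    also have "\<dots> = (\<integral>\<^sup>+ y. 0 \<partial>D.inv_dist)"
      using G by (intro nn_integral_cong_AE) (auto simp: P_outside)
    finally show "D.carried ?p" using 1 by (simp add: D.carried_def)
    show "push ?p ?RR = ?p"
    proof (rule measure_eqI)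
      fix A assume "A \<in> sets (push ?p ?RR)"
      then have A [measurable]: "A \<in> sets borel" by simp
      let ?f = "indicator A :: (nat \<Rightarrow> real) \<Rightarrow> ennreal"
      interpret P: kernel_op "P t" by (rule kernel_P)
      have "emeasure (push ?p ?RR) A = (\<integral>\<^sup>+ y. R (R ?f) y \<partial>?p)"
        by (rule emeasure_push[OF D.kernel_op_axioms _ A]) simp
      also have "\<dots> = (\<integral>\<^sup>+ y. P t (R (R ?f)) y \<partial>D.inv_dist)"
        by (rule nn_integral_push[OF kernel_P sets]) measurable
      also have "\<dots> = (\<integral>\<^sup>+ y. R (R (P t ?f)) y \<partial>D.inv_dist)"
      proof (rule nn_integral_cong_AE, use G in eventually_elim)
        case (elim y)
        have "P t (R (R ?f)) y = R (P t (R ?f)) y"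
          by (rule P_R_commute[OF _ elim t]) measurable
        also have "\<dots> = R (R (P t ?f)) y"
          by (rule R_cong_G[OF elim]) (auto intro: P_R_commute t)
        finally show ?case .
      qed
      also have "\<dots> = (\<integral>\<^sup>+ y. P t ?f y \<partial>push D.inv_dist ?RR)"
        by (rule nn_integral_push[OF D.kernel_op_axioms sets, symmetric]) (rule P.meas, measurable)
      also have "\<dots> = emeasure ?p A"
        by (simp add: D.push_inv_dist e)
      finally show "emeasure (push ?p ?RR) A = emeasure ?p A" .
    qed simp
  qed
  have "stationary_gap m \<theta> D.inv_dist"
    unfolding stationary_gap_def
  proof (intro conjI allI ballI impI)
    show "emeasure D.inv_dist G = 1"
      using inv.prob_eq_1[of G] G sets by (simp add: inv.emeasure_eq_measure)
    fix t :: real and A :: "(nat \<Rightarrow> real) set"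
    assume "0 \<le> t" "A \<in> sets borel"
    then show "(\<integral>\<^sup>+ y. P t (indicator A) y \<partial>D.inv_dist) = emeasure D.inv_dist A"
      using emeasure_push[OF kernel_P sets, of A t] by (simp add: push)
  qed (rule inv.prob_space_axioms sets)+
  with unique show ?thesis by blast
qed

end

theorem theorem3p1:
  fixes n :: nat and \<theta> :: "real measure"
  assumes "n \<ge> 2"
    and "prob_space \<theta>" and "sets \<theta> = sets borel"
    and "AE z in \<theta>. 0 < z"
    and "integrable \<theta> (\<lambda>z. z)" and "(\<integral>z. z \<partial>\<theta>) = 1"
  shows "\<exists>!\<pi>. stationary_gap (n - 1) \<theta> \<pi>"
proof -
  have "ftl (n - 1) \<theta>"
    by (rule ftl.intro) (use assms(1) in simp, fact+)
  then show ?thesis by (rule ftl.ex1_stationary_gap)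
qed

end
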